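(* Let $q$ be an integer with $q>1$, and let $\lambda,\mu$ be real numbers with $\lambda\ge 1$ and $\mu>\lambda q$. Then there exists a solution $\alpha:(0,\frac{\pi}{2})\to\mathbb{R}$ of the ordinary differential equation $$\ddot{\alpha}(t)+(\cot t-q\tan t)\,\dot{\alpha}(t)-\Big(\frac{\lambda}{\sin^2 t}+\frac{\mu}{\cos^2 t}\Big)\sin\alpha(t)\cos\alpha(t)=0,\qquad t\in(0,\tfrac{\pi}{2}),$$ satisfying the boundary conditions $$\lim_{t\to 0^+}\alpha(t)=0,\qquad \lim_{t\to \frac{\pi}{2}-0}\alpha(t)=\pi,$$ and such that $0<\alpha(t)<\pi$ for all $t\in(0,\frac{\pi}{2})$.
   Context: A dot denotes differentiation with respect to $t$. A solution means a classical (twice continuously differentiable) solution on the open interval. In the paper $q$ is the dimension of a sphere $S^q$, and $\lambda,\mu>0$ are the bi-eigenvalues of a bi-eigenmap $S^p\times S^q\to S^n$. The equation is the case $p=1$ of the equation $\ddot{\alpha}+(p\cot t-q\tan t)\dot{\alpha}-(\frac{\lambda}{\sin^2t}+\frac{\mu}{\cos^2t})\sin\alpha\cos\alpha=0$, and the theorem concerns $p=1$. *)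

theory Defs
  imports "HOL-Analysis.Analysis"
begin

end

theory Submission
  imports Defs
begin

text \<open>
  The substitution \<open>x = ln (tan t)\<close> turns the equation into an anti-damped pendulum on the whole line,
  \<open>A'' = h A' + V sin A cos A\<close>, where \<open>s = sin\<^sup>2 t = 1 / (1 + exp (- 2 x))\<close>, \<open>h = (q - 1) s\<close>, and
  \<open>V = lambda + (mu - lambda) s\<close> rises from \<open>lambda\<close> to \<open>mu\<close>. Wanted is a solution that runs from the
  rest point \<open>0\<close> at \<open>- \<infinity>\<close> to the rest point \<open>pi\<close> at \<open>+ \<infinity>\<close>. It is found by shooting.

  Start at a far left point \<open>a\<close> with \<open>A a = p \<in> (0, pi/2]\<close> and \<open>A' a = sqrt lambda sin p\<close>, the slope of
  the connecting orbit of the pendulum with \<open>h = 0\<close> and \<open>V = lambda\<close>. Such a solution passes \<open>pi\<close> while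
  rising (it overshoots), or its slope becomes negative below \<open>pi\<close> (it turns back), or it rises forever
  inside \<open>(0, pi)\<close> (lemma \<open>trichotomy\<close>). The first two cases exclude each other and are open in \<open>p\<close>, so
  if both occur then, an interval being connected, so does the third.

  Small \<open>p\<close> overshoot (\<open>slow_start_overshoots\<close>): a solution that is still below \<open>pi/2\<close> when \<open>s\<close> is close
  to \<open>1\<close> has its slope ratio \<open>y = A' / sin A\<close> pushed above \<open>sqrt mu\<close> by the anti-damping. From then on
  \<open>y\<close> cannot fall below \<open>sqrt mu\<close>, and past \<open>pi/2\<close> it grows without bound, which carries \<open>A\<close> over \<open>pi\<close>.

  A solution that reaches \<open>pi/2\<close> very early turns back (\<open>early_rise_turns_back\<close>). This is the heart of
  the proof, and both hypotheses enter here. Since \<open>V' - 2 h V\<close> is close to \<open>2 (mu - lambda q) s\<close> for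
  small \<open>s\<close>, it is positive there, and the energy \<open>A'\<^sup>2 - V sin\<^sup>2 A\<close>, which starts nonpositive, becomes negative.
  This keeps \<open>A\<close> inside \<open>(0, pi)\<close>. The defect \<open>z = V - y\<^sup>2\<close>, minus the energy divided by \<open>sin\<^sup>2 A\<close>,
  satisfies
  \<open>z' \<ge> (mu - lambda q) s - 2 y z cos A\<close>. After \<open>A\<close> has passed \<open>pi/2\<close>, the last term amplifies \<open>z\<close> at a
  rate close to \<open>2 sqrt lambda \<ge> 2\<close>, hence at least as fast as \<open>s\<close> itself grows, while the first term
  keeps feeding it. So \<open>z / s\<close> grows at least linearly in the time since \<open>pi/2\<close> was passed. If that
  happened early enough, then \<open>z\<close> is of order one while \<open>h\<close> is still negligible, and
  \<open>y' = h y + z cos A\<close> makes \<open>y\<close> negative within bounded time.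

  Both thresholds are independent of \<open>a\<close>: a solution of the third kind is at most \<open>pi/2\<close> at a fixed point
  \<open>M\<close> and at least \<open>pi/2\<close> at a fixed point \<open>X\<close>. As \<open>a\<close> tends to \<open>- \<infinity>\<close>, the data at \<open>M\<close> stay in a compact
  set, and an accumulation point of them starts a solution on the whole line with the same bounds
  (\<open>limiting_solution\<close>). The inequality \<open>A' \<ge> sqrt lambda sin A\<close> to the left of \<open>M\<close> forces the limit \<open>0\<close>
  at \<open>- \<infinity>\<close>; at \<open>+ \<infinity>\<close> a nondecreasing solution can only come to rest at \<open>pi\<close>
  (\<open>connecting_solution\<close>).
\<close>

section \<open>Global solutions of Lipschitz differential equations\<close>

text \<open>
  For either sign of \<open>t\<close> one of the two integrals is over an empty or one-point interval, so this is the
  integral from \<open>0\<close> to \<open>t\<close> in the oriented sense.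
\<close>

definition signed_integral :: "(real \<Rightarrow> 'a::banach) \<Rightarrow> real \<Rightarrow> 'a" where
  "signed_integral g t = integral {0..t} g - integral {t..0} g"

lemma signed_integral_0 [simp]: "signed_integral g 0 = 0"
  by (simp add: signed_integral_def)

lemma signed_integral_has_vector_derivative:
  assumes g: "continuous_on UNIV g"
  shows "(signed_integral g has_vector_derivative g t) (at t)"
proof -
  define B where "B = \<bar>t\<bar> + 1"
  have gi: "g integrable_on {a..b}" for a b
    by (rule integrable_continuous_real) (rule continuous_on_subset[OF g], simp)
  have eq: "integral {-B..s} g - integral {-B..0} g = signed_integral g s" if "s \<in> {-B<..<B}" for s
  proof (cases "0 \<le> s")
    case True
    then have "integral {s..0} g = 0" by (cases "s = 0") auto
    moreover have "integral {-B..0} g + integral {0..s} g = integral {-B..s} g"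
      by (rule Henstock_Kurzweil_Integration.integral_combine) (use True gi B_def in auto)
    ultimately show ?thesis by (simp add: signed_integral_def algebra_simps)
  next
    case False
    moreover have "integral {-B..s} g + integral {s..0} g = integral {-B..0} g"
      by (rule Henstock_Kurzweil_Integration.integral_combine) (use False that gi in auto)
    ultimately show ?thesis by (simp add: signed_integral_def algebra_simps)
  qed
  have tB: "t \<in> {-B<..<B}" by (auto simp: B_def)
  have "((\<lambda>s. integral {-B..s} g) has_vector_derivative g t) (at t within {-B..B})"
    by (rule integral_has_vector_derivative) (use tB in \<open>auto intro: continuous_on_subset[OF g]\<close>)
  then have "((\<lambda>s. integral {-B..s} g) has_vector_derivative g t) (at t)"
    using tB at_within_interior[of t "{-B..B}"] by simp
  then have "((\<lambda>s. integral {-B..s} g - integral {-B..0} g) has_vector_derivative g t) (at t)"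
    by (auto intro!: derivative_eq_intros)
  then show ?thesis
    by (rule has_vector_derivative_transform_within_open[OF _ _ tB eq]) simp
qed

lemma signed_integral_diff:
  assumes "continuous_on UNIV g" "continuous_on UNIV h"
  shows "signed_integral g t - signed_integral h t = signed_integral (\<lambda>s. g s - h s) t"
proof -
  have "g integrable_on {a..b}" "h integrable_on {a..b}" for a b
    using assms by (auto intro!: integrable_continuous_real intro: continuous_on_subset)
  then show ?thesis
    by (simp add: signed_integral_def integral_diff)
qed

text \<open>
  Integration gains a factor \<open>1 / K\<close> on functions of growth \<open>exp (K \<bar>s\<bar>)\<close>; this gain is what makes the
  Picard operator contract on the whole line at once.
\<close>

lemma norm_signed_integral_exp_bound:
  assumes g: "continuous_on UNIV g" and K: "K > 0" and k: "k \<ge> 0"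
    and bnd: "\<And>s. norm (g s) \<le> k * exp (K * \<bar>s\<bar>)"
  shows "norm (signed_integral g t) \<le> k / K * exp (K * \<bar>t\<bar>)"
proof -
  have gi: "g integrable_on {a..b}" for a b
    by (rule integrable_continuous_real) (rule continuous_on_subset[OF g], simp)
  have ci: "(\<lambda>s. k * exp (c * s)) integrable_on {a..b}" for a b c :: real
    by (rule integrable_continuous_real) (intro continuous_intros)
  show ?thesis
  proof (cases "0 \<le> t")
    case True
    then have "signed_integral g t = integral {0..t} g" by (cases "t = 0") (auto simp: signed_integral_def)
    also have "norm \<dots> \<le> integral {0..t} (\<lambda>s. k * exp (K * s))"
      by (rule integral_norm_bound_integral[OF gi ci]) (use bnd in \<open>metis abs_of_nonneg atLeastAtMost_iff\<close>)
    also have "((\<lambda>s. k * exp (K * s)) has_integral (k / K * exp (K * t) - k / K * exp (K * 0))) {0..t}"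
      by (rule fundamental_theorem_of_calculus[OF True])
        (use K in \<open>auto intro!: derivative_eq_intros simp: has_real_derivative_iff_has_vector_derivative[symmetric]\<close>)
    then have "integral {0..t} (\<lambda>s. k * exp (K * s)) = k / K * exp (K * t) - k / K * exp (K * 0)"
      by (rule integral_unique)
    also have "\<dots> \<le> k / K * exp (K * \<bar>t\<bar>)" using True K k by simp
    finally show ?thesis .
  next
    case False
    then have t: "t \<le> 0" by simp
    from False have "norm (signed_integral g t) = norm (integral {t..0} g)" by (auto simp: signed_integral_def)
    also have "\<dots> \<le> integral {t..0} (\<lambda>s. k * exp ((-K) * s))"
      by (rule integral_norm_bound_integral[OF gi ci])
         (use bnd in \<open>metis abs_of_nonpos atLeastAtMost_iff minus_mult_commute\<close>)
    also have "((\<lambda>s. k * exp ((-K) * s)) has_integral ((-k / K) * exp ((-K) * 0) - (-k / K) * exp ((-K) * t))) {t..0}"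
      by (rule fundamental_theorem_of_calculus[OF t])
        (use K in \<open>auto intro!: derivative_eq_intros simp: has_real_derivative_iff_has_vector_derivative[symmetric]\<close>)
    then have "integral {t..0} (\<lambda>s. k * exp ((-K) * s)) = (-k / K) * exp ((-K) * 0) - (-k / K) * exp ((-K) * t)"
      by (rule integral_unique)
    also have "\<dots> \<le> k / K * exp (K * \<bar>t\<bar>)" using False K k by simp
    finally show ?thesis .
  qed
qed

text \<open>
  Picard iteration in the space of continuous functions that grow at most like \<open>exp (2 L \<bar>t\<bar>)\<close>. Writing
  a candidate as \<open>u0 + exp (2 L \<bar>t\<bar>) w t\<close> with \<open>w\<close> bounded and continuous turns this space into the
  complete space of the \<open>w\<close>, on which the operator has Lipschitz constant \<open>L / (2 L) = 1/2\<close>. A single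
  application of the contraction principle then gives the solution for all times, without continuation.
\<close>

theorem global_solution_exists:
  fixes f :: "real \<Rightarrow> 'a::banach \<Rightarrow> 'a"
  assumes cont: "\<And>u. continuous_on UNIV u \<Longrightarrow> continuous_on UNIV (\<lambda>t. f t (u t))"
    and L: "L > 0" and lip: "\<And>t u v. norm (f t u - f t v) \<le> L * norm (u - v)"
    and bnd: "\<And>t. norm (f t u0) \<le> B"
  shows "\<exists>u. u 0 = u0 \<and> (\<forall>t. (u has_vector_derivative f t (u t)) (at t))"
proof -
  define K where "K = 2 * L"
  have K: "K > 0" using L by (simp add: K_def)
  have B: "B \<ge> 0" using bnd[of 0] norm_ge_zero order_trans by blast
  define c where "c w t = u0 + exp (K * \<bar>t\<bar>) *\<^sub>R apply_bcontfun w t" for w :: "real \<Rightarrow>\<^sub>C 'a" and t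
  have cc: "continuous_on UNIV (c w)" for w
    unfolding c_def by (intro continuous_intros) auto
  have fc: "continuous_on UNIV (\<lambda>t. f t (c w t))" for w
    by (rule cont[OF cc])
  define T where "T w t = exp (- K * \<bar>t\<bar>) *\<^sub>R signed_integral (\<lambda>s. f s (c w s)) t" for w t
  have ci: "continuous_on UNIV (signed_integral (\<lambda>s. f s (c w s)))" for w
    using signed_integral_has_vector_derivative[OF fc]
    by (meson continuous_at_imp_continuous_on has_vector_derivative_continuous)
  have "T w \<in> bcontfun" for w
  proof (rule bcontfun_normI)
    show "continuous_on UNIV (T w)"
      unfolding T_def by (intro continuous_intros ci)
    fix t
    have "norm (signed_integral (\<lambda>s. f s (c w s)) t) \<le> (B + L * norm w) / K * exp (K * \<bar>t\<bar>)"
    proof (rule norm_signed_integral_exp_bound[OF fc K])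
      show "0 \<le> B + L * norm w" using B L by simp
      fix s
      have "norm (f s (c w s)) \<le> norm (f s u0) + norm (f s (c w s) - f s u0)"
        by (metis add.commute diff_add_cancel norm_triangle_ineq)
      also have "\<dots> \<le> B + L * norm (c w s - u0)"
        by (intro add_mono bnd lip)
      also have "norm (c w s - u0) \<le> exp (K * \<bar>s\<bar>) * norm w"
        by (simp add: c_def norm_bounded)
      also have "B + L * (exp (K * \<bar>s\<bar>) * norm w) \<le> B * exp (K * \<bar>s\<bar>) + L * (exp (K * \<bar>s\<bar>) * norm w)"
        using mult_left_mono[of 1 "exp (K * \<bar>s\<bar>)" B] B K by simp
      finally show "norm (f s (c w s)) \<le> (B + L * norm w) * exp (K * \<bar>s\<bar>)"
        using L by (simp add: algebra_simps)
    qed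
    then show "norm (T w t) \<le> (B + L * norm w) / K"
      by (simp add: T_def exp_minus field_simps)
  qed
  then have appT: "apply_bcontfun (Bcontfun (T w)) = T w" for w
    by (simp add: Bcontfun_inverse)
  have "\<exists>!w. Bcontfun (T w) = w"
  proof (rule banach_fix_type[of "1/2"])
    show "\<forall>w w'. dist (Bcontfun (T w)) (Bcontfun (T w')) \<le> 1/2 * dist w w'"
    proof (intro allI dist_bound)
      fix w w' :: "real \<Rightarrow>\<^sub>C 'a" and t
      have "norm (signed_integral (\<lambda>s. f s (c w s) - f s (c w' s)) t) \<le> (L * dist w w') / K * exp (K * \<bar>t\<bar>)"
      proof (rule norm_signed_integral_exp_bound[OF _ K])
        show "continuous_on UNIV (\<lambda>s. f s (c w s) - f s (c w' s))"
          by (intro continuous_intros fc)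
        show "0 \<le> L * dist w w'" using L by simp
        fix s
        have "norm (f s (c w s) - f s (c w' s)) \<le> L * norm (c w s - c w' s)" by (rule lip)
        also have "norm (c w s - c w' s) = exp (K * \<bar>s\<bar>) * dist (w s) (w' s)"
          by (simp add: c_def dist_norm scaleR_diff_right[symmetric])
        also have "dist (w s) (w' s) \<le> dist w w'" by (rule dist_bounded)
        finally show "norm (f s (c w s) - f s (c w' s)) \<le> L * dist w w' * exp (K * \<bar>s\<bar>)"
          using L by (simp add: algebra_simps)
      qed
      then have "exp (- K * \<bar>t\<bar>) * norm (signed_integral (\<lambda>s. f s (c w s) - f s (c w' s)) t)
          \<le> exp (- K * \<bar>t\<bar>) * ((L * dist w w') / K * exp (K * \<bar>t\<bar>))"
        by (rule mult_left_mono) simp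
      moreover have "dist (T w t) (T w' t) = exp (- K * \<bar>t\<bar>) * norm (signed_integral (\<lambda>s. f s (c w s) - f s (c w' s)) t)"
        by (simp add: T_def dist_norm scaleR_diff_right[symmetric] signed_integral_diff[OF fc fc])
      ultimately have "dist (T w t) (T w' t) \<le> exp (- K * \<bar>t\<bar>) * ((L * dist w w') / K * exp (K * \<bar>t\<bar>))"
        by simp
      also have "\<dots> = 1/2 * dist w w'"
        using L by (simp add: K_def exp_minus field_simps)
      finally show "dist (apply_bcontfun (Bcontfun (T w)) t) (apply_bcontfun (Bcontfun (T w')) t) \<le> 1/2 * dist w w'"
        by (simp add: appT)
    qed
  qed auto
  then obtain w where w: "Bcontfun (T w) = w" by blast
  have eq: "c w t = u0 + signed_integral (\<lambda>s. f s (c w s)) t" for t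
  proof -
    have "apply_bcontfun w = T w"
      by (rule trans[OF arg_cong[OF w[symmetric], of apply_bcontfun] appT])
    then have "apply_bcontfun w t = T w t" by (rule fun_cong)
    then have "c w t = u0 + exp (K * \<bar>t\<bar>) *\<^sub>R T w t" by (simp only: c_def)
    then show ?thesis by (simp only: T_def scaleR_scaleR exp_add[symmetric]) simp
  qed
  have "(c w has_vector_derivative f t (c w t)) (at t)" for t
  proof -
    have "((\<lambda>t. u0 + signed_integral (\<lambda>s. f s (c w s)) t) has_vector_derivative f t (c w t)) (at t)"
      by (auto intro!: derivative_eq_intros signed_integral_has_vector_derivative fc)
    moreover have "(\<lambda>t. u0 + signed_integral (\<lambda>s. f s (c w s)) t) = c w"
      by (rule ext) (rule eq[symmetric])
    ultimately show ?thesis by (simp only:)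
  qed
  moreover have "c w 0 = u0" by (subst eq) simp
  ultimately show ?thesis by blast
qed

text \<open>
  With an antiderivative \<open>P\<close> of \<open>p\<close>, the product \<open>u exp (- P)\<close> is nondecreasing.
\<close>

lemma linear_differential_inequality:
  fixes u u' p :: "real \<Rightarrow> real"
  assumes ab: "a \<le> b" and p: "continuous_on UNIV p"
    and der: "\<And>x. a \<le> x \<Longrightarrow> x \<le> b \<Longrightarrow> (u has_real_derivative u' x) (at x)"
    and ineq: "\<And>x. a \<le> x \<Longrightarrow> x \<le> b \<Longrightarrow> p x * u x \<le> u' x"
    and ua: "0 \<le> u a"
  shows "0 \<le> u b"
proof -
  have P: "(signed_integral p has_real_derivative p x) (at x)" for x
    using signed_integral_has_vector_derivative[OF p] by (simp add: has_real_derivative_iff_has_vector_derivative)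
  have "u a * exp (- signed_integral p a) \<le> u b * exp (- signed_integral p b)"
  proof (rule DERIV_nonneg_imp_nondecreasing[OF ab])
    fix x assume x: "a \<le> x" "x \<le> b"
    have "((\<lambda>x. u x * exp (- signed_integral p x)) has_real_derivative (u' x - p x * u x) * exp (- signed_integral p x)) (at x)"
      by (auto intro!: derivative_eq_intros der[OF x] P simp: algebra_simps)
    moreover have "(u' x - p x * u x) * exp (- signed_integral p x) \<ge> 0" using ineq[OF x] by simp
    ultimately show "\<exists>y. ((\<lambda>x. u x * exp (- signed_integral p x)) has_real_derivative y) (at x) \<and> 0 \<le> y" by blast
  qed
  moreover have "0 \<le> u a * exp (- signed_integral p a)" using ua by simp
  ultimately have "0 \<le> u b * exp (- signed_integral p b)" by linarith
  then show ?thesis by (simp add: zero_le_mult_iff)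
qed

section \<open>Auxiliary facts on real functions\<close>

lemma derivative_lower_bound:
  fixes u u' :: "real \<Rightarrow> real"
  assumes ab: "a \<le> b" and "\<And>x. a \<le> x \<Longrightarrow> x \<le> b \<Longrightarrow> (u has_real_derivative u' x) (at x)"
    and "\<And>x. a \<le> x \<Longrightarrow> x \<le> b \<Longrightarrow> c \<le> u' x"
  shows "u a + c * (b - a) \<le> u b"
proof -
  have "u a - c * a \<le> u b - c * b"
    by (rule DERIV_nonneg_imp_nondecreasing[OF ab])
      (use assms in \<open>force intro!: derivative_eq_intros\<close>)
  then show ?thesis by (simp add: algebra_simps)
qed

lemma first_zero:
  fixes f :: "real \<Rightarrow> real"
  assumes "continuous_on {a..b} f" "a \<le> b" "f a < 0" "0 \<le> f b"
  obtains T where "a < T" "T \<le> b" "f T = 0" "\<And>x. a \<le> x \<Longrightarrow> x < T \<Longrightarrow> f x < 0"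
proof -
  define S where "S = {x \<in> {a..b}. 0 \<le> f x}"
  have "closed ({a..b} \<inter> f -` {0..})"
    by (intro continuous_closed_preimage assms) auto
  moreover have "{a..b} \<inter> f -` {0..} = S" by (auto simp: S_def)
  moreover have "bounded S" by (rule bounded_subset[of "{a..b}"]) (auto simp: S_def)
  ultimately have "compact S" by (simp add: compact_eq_bounded_closed)
  moreover have "b \<in> S" using assms by (simp add: S_def)
  ultimately obtain T where T: "T \<in> S" "\<And>x. x \<in> S \<Longrightarrow> T \<le> x"
    using compact_attains_inf[of S] by blast
  have neg: "f x < 0" if "a \<le> x" "x < T" for x
    using T(2)[of x] that T(1) by (force simp: S_def)
  have aT: "a < T" using T(1) assms(3) by (cases "a = T") (auto simp: S_def)
  have "f T \<le> 0"
  proof (rule ccontr)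
    assume "\<not> f T \<le> 0"
    then have "\<exists>x\<ge>a. x \<le> T \<and> f x = 0"
      using assms aT T(1) by (intro IVT') (auto simp: S_def intro: continuous_on_subset)
    then obtain x where "a \<le> x" "x \<le> T" "f x = 0" by blast
    then show False using neg[of x] \<open>\<not> f T \<le> 0\<close> by (cases "x = T") auto
  qed
  then show thesis using T(1) aT neg by (intro that[of T]) (auto simp: S_def)
qed

lemma sin_cos_lipschitz: "\<bar>sin a * cos a - sin b * cos b\<bar> \<le> \<bar>a - b\<bar>" for a b :: real
proof -
  have "sin a * cos a - sin b * cos b = (sin (2*a) - sin (2*b)) / 2"
    by (simp add: sin_double)
  also have "sin (2*a) - sin (2*b) = 2 * sin (a - b) * cos (a + b)"
    using sin_diff_sin[of "2*a" "2*b"] by (simp add: diff_divide_distrib add_divide_distrib)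
  finally have "\<bar>sin a * cos a - sin b * cos b\<bar> = \<bar>sin (a - b)\<bar> * \<bar>cos (a + b)\<bar>"
    by (simp add: abs_mult)
  also have "\<dots> \<le> \<bar>a - b\<bar> * 1"
    by (intro mult_mono abs_sin_x_le_abs_x) auto
  finally show ?thesis by simp
qed

lemma sin_lipschitz: "\<bar>sin a - sin b\<bar> \<le> \<bar>a - b\<bar>" for a b :: real
proof -
  have "sin a - sin b = 2 * sin ((a - b) / 2) * cos ((a + b) / 2)" by (rule sin_diff_sin)
  then have "\<bar>sin a - sin b\<bar> = 2 * (\<bar>sin ((a - b) / 2)\<bar> * \<bar>cos ((a + b) / 2)\<bar>)" by (simp add: abs_mult)
  also have "\<dots> \<le> 2 * (\<bar>(a - b) / 2\<bar> * 1)"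
    by (intro mult_left_mono mult_mono abs_sin_x_le_abs_x) auto
  finally show ?thesis by simp
qed

text \<open>
  This is \<open>sin\<^sup>2 t\<close> as a function of \<open>x = ln (tan t)\<close>. Its logarithmic derivative \<open>2 (1 - logistic x)\<close>
  is less than \<open>2\<close>, the rate to which \<open>2 sqrt lambda\<close> is compared below.
\<close>

definition logistic :: "real \<Rightarrow> real" where
  "logistic x = 1 / (1 + exp (- 2 * x))"

lemma logistic_pos: "0 < logistic x" and logistic_less_1: "logistic x < 1"
  by (auto simp: logistic_def add_pos_pos)

lemma logistic_deriv:
  "(logistic has_real_derivative 2 * logistic x * (1 - logistic x)) (at x)"
proof -
  have p: "1 + exp (- 2 * x) \<noteq> 0" by (smt (verit) exp_gt_zero)
  have "((\<lambda>x. 1 / (1 + exp (- 2 * x))) has_real_derivative (2 * exp (-2*x)) / (1 + exp (- 2 * x))\<^sup>2) (at x)"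
    by (rule derivative_eq_intros refl p | use p in \<open>simp add: power2_eq_square\<close>)+
  moreover have "(2 * exp (-2*x)) / (1 + exp (- 2 * x))\<^sup>2 = 2 * logistic x * (1 - logistic x)"
    using p by (simp add: logistic_def field_simps power2_eq_square)
  ultimately show ?thesis by (simp add: logistic_def[abs_def])
qed

lemma logistic_mono: "x \<le> y \<Longrightarrow> logistic x \<le> logistic y"
  by (auto simp: logistic_def intro!: divide_left_mono add_pos_pos mult_pos_pos)

lemma isCont_logistic: "isCont logistic x"
  using logistic_deriv DERIV_isCont by blast

lemma continuous_on_logistic: "continuous_on S logistic"
  using isCont_logistic by (simp add: continuous_at_imp_continuous_on)

lemma exists_logistic_less: assumes "e > 0" shows "\<exists>x. logistic x < e"
proof -
  have "logistic (ln e / 2) < e"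
    using assms by (simp add: logistic_def exp_minus field_simps)
  then show ?thesis ..
qed

lemma exists_logistic_greater: assumes "e < 1" shows "\<exists>x. e < logistic x"
proof -
  have "(1 - (1 - e)\<^sup>2) < 1" using assms by simp
  then have "e < logistic (- ln (1 - e) / 2)"
    using assms by (simp add: logistic_def field_simps power2_eq_square)
  then show ?thesis ..
qed

section \<open>The equation on the line\<close>

text \<open>
  Here \<open>kappa\<close> stands for \<open>q - 1\<close>, which may be any positive real number; the third assumption then reads
  \<open>mu > lambda q\<close>.
\<close>

locale join_equation =
  fixes kappa lambda mu :: real
  assumes kappa: "kappa > 0" and lambda: "lambda \<ge> 1" and mu: "mu - lambda > lambda * kappa"
begin

definition h :: "real \<Rightarrow> real" where "h x = kappa * logistic x"
definition V :: "real \<Rightarrow> real" where "V x = lambda + (mu - lambda) * logistic x"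

definition force :: "real \<Rightarrow> real \<Rightarrow> real \<Rightarrow> real" where
  "force x a b = h x * b + V x * sin a * cos a"

text \<open>
  The second component \<open>B\<close> is the derivative of \<open>A\<close>. Solutions live on the whole line, which costs
  nothing because the equation is globally Lipschitz.
\<close>

definition solution :: "(real \<Rightarrow> real) \<Rightarrow> (real \<Rightarrow> real) \<Rightarrow> bool" where
  "solution A B \<longleftrightarrow> (\<forall>x. (A has_real_derivative B x) (at x)
      \<and> (B has_real_derivative force x (A x) (B x)) (at x))"

lemma lambda_less_mu: "lambda < mu"
  using kappa lambda mu mult_pos_pos[of lambda kappa] by linarith

lemma h_pos: "0 < h x" and h_le: "h x \<le> kappa"
  using kappa logistic_pos[of x] logistic_less_1[of x] by (auto simp: h_def mult_le_cancel_left2)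

lemma V_gt: "lambda < V x" and V_le: "V x \<le> mu"
proof -
  show "lambda < V x" using lambda_less_mu logistic_pos[of x] by (simp add: V_def)
  have "(mu - lambda) * logistic x \<le> (mu - lambda) * 1"
    using lambda_less_mu logistic_less_1[of x] by (intro mult_left_mono) auto
  then show "V x \<le> mu" by (simp add: V_def)
qed

lemma V_pos: "0 < V x" using V_gt[of x] lambda by simp

lemma continuous_on_h: "continuous_on S h" and continuous_on_V: "continuous_on S V"
  unfolding h_def V_def by (intro continuous_intros continuous_on_logistic)+

lemma V_deriv: "(V has_real_derivative 2 * (mu - lambda) * logistic x * (1 - logistic x)) (at x)"
  unfolding V_def by (auto intro!: derivative_eq_intros logistic_deriv)

lemma solution_deriv:
  assumes "solution A B"
  shows "(A has_real_derivative B x) (at x)" "(B has_real_derivative force x (A x) (B x)) (at x)"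
  using assms by (auto simp: solution_def)

lemma solution_continuous:
  assumes "solution A B"
  shows "continuous_on S A" "continuous_on S B"
  using solution_deriv[OF assms] by (meson DERIV_isCont continuous_at_imp_continuous_on)+

lemma force_lipschitz: "\<bar>force x a b - force x a' b'\<bar> \<le> kappa * \<bar>b - b'\<bar> + mu * \<bar>a - a'\<bar>"
proof -
  have "force x a b - force x a' b' = h x * (b - b') + V x * (sin a * cos a - sin a' * cos a')"
    by (simp add: force_def algebra_simps)
  then have "\<bar>force x a b - force x a' b'\<bar> \<le> h x * \<bar>b - b'\<bar> + V x * \<bar>sin a * cos a - sin a' * cos a'\<bar>"
    using abs_triangle_ineq[of "h x * (b - b')" "V x * (sin a * cos a - sin a' * cos a')"]
      h_pos[of x] V_pos[of x] by (simp add: abs_mult)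
  also have "\<dots> \<le> kappa * \<bar>b - b'\<bar> + mu * \<bar>a - a'\<bar>"
    using h_le[of x] V_le[of x] h_pos[of x] V_pos[of x] kappa lambda_less_mu lambda
    by (intro add_mono mult_mono sin_cos_lipschitz) auto
  finally show ?thesis .
qed

lemma solution_exists: "\<exists>A B. solution A B \<and> A x0 = a \<and> B x0 = b"
proof -
  define f where "f t u = (snd u, force (t + x0) (fst u) (snd u))" for t and u :: "real \<times> real"
  define L where "L = 1 + kappa + mu"
  have pos: "kappa > 0" "mu > 0" using kappa lambda lambda_less_mu by auto
  have "\<exists>u. u 0 = (a, b) \<and> (\<forall>t. (u has_vector_derivative f t (u t)) (at t))"
  proof (rule global_solution_exists[where L = L and B = "\<bar>b\<bar> + (kappa * \<bar>b\<bar> + mu)"])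
    fix u :: "real \<Rightarrow> real \<times> real" assume u: "continuous_on UNIV u"
    show "continuous_on UNIV (\<lambda>t. f t (u t))"
      unfolding f_def force_def h_def V_def
      by (intro continuous_intros continuous_on_fst continuous_on_snd u
          continuous_on_compose2[OF continuous_on_logistic]) auto
  next
    show "L > 0" using pos by (simp add: L_def)
  next
    fix t and u v :: "real \<times> real"
    have n: "\<bar>fst u - fst v\<bar> \<le> norm (u - v)" "\<bar>snd u - snd v\<bar> \<le> norm (u - v)"
      using norm_fst_le[where x = "fst u - fst v" and y = "snd u - snd v"]
        norm_snd_le[where x = "fst u - fst v" and y = "snd u - snd v"] by (auto simp: minus_prod_def)
    have "norm (f t u - f t v) \<le> \<bar>snd u - snd v\<bar> + \<bar>force (t + x0) (fst u) (snd u) - force (t + x0) (fst v) (snd v)\<bar>"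
      unfolding f_def diff_Pair by (rule order_trans[OF norm_Pair_le]) simp
    also have "\<dots> \<le> \<bar>snd u - snd v\<bar> + (kappa * \<bar>snd u - snd v\<bar> + mu * \<bar>fst u - fst v\<bar>)"
      by (intro add_left_mono force_lipschitz)
    also have "\<dots> \<le> norm (u - v) + (kappa * norm (u - v) + mu * norm (u - v))"
      using pos n by (intro add_mono mult_left_mono) auto
    finally show "norm (f t u - f t v) \<le> L * norm (u - v)"
      by (simp add: L_def algebra_simps)
  next
    fix t
    have "\<bar>force (t + x0) a b - force (t + x0) 0 0\<bar> \<le> kappa * \<bar>b\<bar> + V (t + x0) * 1"
    proof -
      have "\<bar>force (t + x0) a b - force (t + x0) 0 0\<bar> \<le> \<bar>h (t + x0) * b\<bar> + V (t + x0) * \<bar>sin a * cos a\<bar>"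
        using abs_triangle_ineq[of "h (t + x0) * b" "V (t + x0) * sin a * cos a"] V_pos[of "t + x0"]
        by (simp add: force_def abs_mult mult.assoc)
      also have "\<bar>sin a * cos a\<bar> \<le> 1"
        using mult_mono[OF abs_sin_le_one abs_cos_le_one, of a a] by (simp add: abs_mult)
      finally show ?thesis
        using h_le[of "t + x0"] h_pos[of "t + x0"] V_pos[of "t + x0"]
          mult_right_mono[of "h (t + x0)" kappa "\<bar>b\<bar>"]
        by (auto simp: abs_mult)
    qed
    then have "\<bar>force (t + x0) a b\<bar> \<le> kappa * \<bar>b\<bar> + mu"
      using V_le[of "t + x0"] by (simp add: force_def)
    moreover have "norm (f t (a, b)) \<le> \<bar>b\<bar> + \<bar>force (t + x0) a b\<bar>"
      unfolding f_def by (rule order_trans[OF norm_Pair_le]) simp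
    ultimately show "norm (f t (a, b)) \<le> \<bar>b\<bar> + (kappa * \<bar>b\<bar> + mu)" by linarith
  qed
  then obtain u where u0: "u 0 = (a, b)" and u: "\<And>t. (u has_vector_derivative f t (u t)) (at t)"
    by blast
  have 1: "((\<lambda>x. fst (u x)) has_real_derivative snd (u t)) (at t)" for t
    using bounded_linear.has_vector_derivative[OF bounded_linear_fst u[of t]]
    by (simp add: f_def has_real_derivative_iff_has_vector_derivative)
  have 2: "((\<lambda>x. snd (u x)) has_real_derivative force (t + x0) (fst (u t)) (snd (u t))) (at t)" for t
    using bounded_linear.has_vector_derivative[OF bounded_linear_snd u[of t]]
    by (simp add: f_def has_real_derivative_iff_has_vector_derivative)
  have "solution (\<lambda>x. fst (u (x - x0))) (\<lambda>x. snd (u (x - x0)))"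
    unfolding solution_def
    using 1[THEN DERIV_shift[THEN iffD1, of _ _ _ "- x0"]] 2[THEN DERIV_shift[THEN iffD1, of _ _ _ "- x0"]]
    by (auto intro!: DERIV_chain2[OF 1, THEN DERIV_cong] DERIV_chain2[OF 2, THEN DERIV_cong] derivative_eq_intros)
  with u0 show ?thesis
    by (intro exI[of _ "\<lambda>x. fst (u (x - x0))"] exI[of _ "\<lambda>x. snd (u (x - x0))"]) auto
qed

definition growth :: real where "growth = 1 + mu + 2 * kappa"

text \<open>
  The squared distance \<open>D\<close> of two solutions satisfies \<open>\<bar>D'\<bar> \<le> growth * D\<close>, so \<open>D\<close> changes at most by the
  exponential factor, forwards as well as backwards. Uniqueness and continuous dependence both follow.
\<close>

lemma solution_dependence:
  assumes s: "solution A B" and s': "solution A' B'"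
  shows "(A x - A' x)\<^sup>2 + (B x - B' x)\<^sup>2
    \<le> ((A x0 - A' x0)\<^sup>2 + (B x0 - B' x0)\<^sup>2) * exp (growth * \<bar>x - x0\<bar>)"
proof -
  define D where "D x = (A x - A' x)\<^sup>2 + (B x - B' x)\<^sup>2" for x
  define D' where "D' x = 2 * (A x - A' x) * (B x - B' x)
     + 2 * (B x - B' x) * (force x (A x) (B x) - force x (A' x) (B' x))" for x
  have pos: "kappa > 0" "mu > 0" using kappa lambda lambda_less_mu by auto
  have D: "(D has_real_derivative D' x) (at x)" for x
    unfolding D_def D'_def
    by (auto intro!: derivative_eq_intros solution_deriv[OF s] solution_deriv[OF s']
        simp: algebra_simps)
  have bnd: "\<bar>D' x\<bar> \<le> growth * D x" for x
  proof -
    let ?a = "\<bar>A x - A' x\<bar>" and ?b = "\<bar>B x - B' x\<bar>"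
    have "\<bar>D' x\<bar> \<le> 2 * ?a * ?b + 2 * ?b * \<bar>force x (A x) (B x) - force x (A' x) (B' x)\<bar>"
      unfolding D'_def by (rule order_trans[OF abs_triangle_ineq]) (simp only: abs_mult abs_numeral order_refl)
    also have "\<dots> \<le> 2 * ?a * ?b + 2 * ?b * (kappa * ?b + mu * ?a)"
      by (intro add_left_mono mult_left_mono force_lipschitz) auto
    also have "\<dots> = (1 + mu) * (2 * ?a * ?b) + 2 * kappa * ?b\<^sup>2"
      by (simp add: algebra_simps power2_eq_square)
    also have "\<dots> \<le> (1 + mu) * (?a\<^sup>2 + ?b\<^sup>2) + 2 * kappa * (?a\<^sup>2 + ?b\<^sup>2)"
      using pos sum_squares_bound[of ?a ?b] by (intro add_mono mult_left_mono) auto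
    also have "\<dots> = growth * D x" by (simp add: growth_def D_def algebra_simps)
    finally show ?thesis .
  qed
  have "D x \<le> D x0 * exp (growth * \<bar>x - x0\<bar>)"
  proof (cases "x0 \<le> x")
    case True
    have "D x0 * exp (- growth * x0) \<ge> D x * exp (- growth * x)"
    proof (rule DERIV_nonpos_imp_nonincreasing[OF True])
      fix y
      have "((\<lambda>x. D x * exp (- growth * x)) has_real_derivative (D' y - growth * D y) * exp (- growth * y)) (at y)"
        by (auto intro!: derivative_eq_intros D simp: algebra_simps)
      moreover have "(D' y - growth * D y) * exp (- growth * y) \<le> 0"
        using bnd[of y] by (simp add: mult_le_0_iff)
      ultimately show "\<exists>d. ((\<lambda>x. D x * exp (- growth * x)) has_real_derivative d) (at y) \<and> d \<le> 0" by blast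
    qed
    then have "D x * exp (- growth * x) * exp (growth * x) \<le> D x0 * exp (- growth * x0) * exp (growth * x)"
      by (intro mult_right_mono) auto
    then show ?thesis using True by (simp add: mult.assoc exp_add[symmetric] algebra_simps)
  next
    case False
    then have le: "x \<le> x0" by simp
    have "D x * exp (growth * x) \<le> D x0 * exp (growth * x0)"
    proof (rule DERIV_nonneg_imp_nondecreasing[OF le])
      fix y
      have "((\<lambda>x. D x * exp (growth * x)) has_real_derivative (D' y + growth * D y) * exp (growth * y)) (at y)"
        by (auto intro!: derivative_eq_intros D simp: algebra_simps)
      moreover have "(D' y + growth * D y) * exp (growth * y) \<ge> 0"
        using bnd[of y] by simp
      ultimately show "\<exists>d. ((\<lambda>x. D x * exp (growth * x)) has_real_derivative d) (at y) \<and> d \<ge> 0" by blast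
    qed
    then have "D x * exp (growth * x) * exp (- growth * x) \<le> D x0 * exp (growth * x0) * exp (- growth * x)"
      by (intro mult_right_mono) auto
    then show ?thesis using le by (simp add: mult.assoc exp_add[symmetric] algebra_simps)
  qed
  then show ?thesis by (simp add: D_def)
qed

text \<open>
  The rest points are the multiples of \<open>pi/2\<close>. A solution can never arrive at one of them with zero
  speed, which excludes all degenerate cases in the arguments below.
\<close>

lemma equilibrium_unique:
  assumes s: "solution A B" and "sin c * cos c = 0" "A x0 = c" "B x0 = 0"
  shows "A x = c \<and> B x = 0"
proof -
  have c: "solution (\<lambda>_. c) (\<lambda>_. 0)"
    using assms(2) by (auto simp: solution_def force_def mult.assoc)
  have "(A x - c)\<^sup>2 + (B x - 0)\<^sup>2 \<le> 0"
    using solution_dependence[OF s c, of x x0] assms by simp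
  then show ?thesis by (simp add: sum_power2_le_zero_iff)
qed

section \<open>Slopes\<close>

text \<open>
  The excess of the slope over \<open>m sin A\<close> obeys a linear equation whose inhomogeneity has the sign of
  \<open>h m + (V - m\<^sup>2) cos A\<close> as long as \<open>sin A\<close> is positive. Where that is nonnegative, the lower bound
  \<open>m sin A\<close> on the slope persists.
\<close>

lemma slope_deriv:
  assumes s: "solution A B"
  shows "((\<lambda>x. B x - m * sin (A x)) has_real_derivative
     (h x - m * cos (A x)) * (B x - m * sin (A x)) + sin (A x) * (h x * m + (V x - m\<^sup>2) * cos (A x))) (at x)"
proof -
  have "((\<lambda>x. B x - m * sin (A x)) has_real_derivative
     force x (A x) (B x) - m * (cos (A x) * B x)) (at x)"
    by (auto intro!: derivative_eq_intros solution_deriv[OF s])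
  then show ?thesis
    by (rule DERIV_cong) (simp add: force_def algebra_simps power2_eq_square)
qed

lemma slope_bound_propagates:
  assumes s: "solution A B" and ab: "a \<le> b" and init: "m * sin (A a) \<le> B a"
    and pos: "\<And>x. a \<le> x \<Longrightarrow> x \<le> b \<Longrightarrow> 0 \<le> sin (A x) \<and> 0 \<le> h x * m + (V x - m\<^sup>2) * cos (A x)"
  shows "m * sin (A b) \<le> B b"
proof -
  have "0 \<le> B b - m * sin (A b)"
  proof (rule linear_differential_inequality[where a = a and p = "\<lambda>x. h x - m * cos (A x)", OF ab _ slope_deriv[OF s]])
    show "continuous_on UNIV (\<lambda>x. h x - m * cos (A x))"
      by (intro continuous_intros continuous_on_h solution_continuous[OF s])
  qed (use pos init in auto)
  then show ?thesis by simp
qed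

text \<open>
  The slope ratio \<open>y = A' / sin A\<close> is the derivative of \<open>ln (tan (A / 2))\<close> and satisfies a Riccati
  equation; on the orbits connecting \<open>0\<close> to \<open>pi\<close> for constant \<open>V\<close> and \<open>h = 0\<close> it is constantly \<open>sqrt V\<close>.
\<close>

lemma ratio_deriv:
  assumes s: "solution A B" and nz: "sin (A x) \<noteq> 0"
  shows "((\<lambda>x. B x / sin (A x)) has_real_derivative
    h x * (B x / sin (A x)) + (V x - (B x / sin (A x))\<^sup>2) * cos (A x)) (at x)"
proof -
  have "((\<lambda>x. B x / sin (A x)) has_real_derivative
     (force x (A x) (B x) * sin (A x) - B x * (cos (A x) * B x)) / (sin (A x) * sin (A x))) (at x)"
    by (rule DERIV_divide solution_deriv[OF s] nz DERIV_chain2[OF DERIV_sin])+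
  then show ?thesis
    by (rule DERIV_cong) (use nz in \<open>simp add: force_def field_simps power2_eq_square\<close>)
qed

text \<open>
  The lower bound on the slope needs \<open>A \<ge> 0\<close>, and conversely it makes \<open>A\<close> nondecreasing; looking at the
  first zero of \<open>A\<close> breaks the circle.
\<close>

lemma slope_bound_stays:
  assumes s: "solution A B" and m: "0 \<le> m" and Aa: "0 < A a" and init: "m * sin (A a) \<le> B a"
    and bnd: "\<And>x. a \<le> x \<Longrightarrow> x \<le> b \<Longrightarrow> A x \<le> pi"
    and m_ok: "\<And>x. a \<le> x \<Longrightarrow> x \<le> b \<Longrightarrow> 0 \<le> A x \<Longrightarrow> 0 \<le> h x * m + (V x - m\<^sup>2) * cos (A x)"
    and x: "a \<le> x" "x \<le> b"
  shows "A a \<le> A x" "m * sin (A x) \<le> B x"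
proof -
  have main: "A a \<le> A y \<and> m * sin (A y) \<le> B y" if y: "a \<le> y" "y \<le> b"
    and nn: "\<And>x. a \<le> x \<Longrightarrow> x \<le> y \<Longrightarrow> 0 \<le> A x" for y
  proof -
    have B: "m * sin (A z) \<le> B z" if z: "a \<le> z" "z \<le> y" for z
      by (rule slope_bound_propagates[OF s z(1) init]) (use z y nn bnd m_ok in \<open>auto intro!: sin_ge_zero\<close>)
    have "A a \<le> A y"
    proof (rule DERIV_nonneg_imp_nondecreasing[OF y(1)])
      fix z assume z: "a \<le> z" "z \<le> y"
      have "0 \<le> m * sin (A z)"
        using m nn[OF z] bnd[of z] z y by (auto intro!: mult_nonneg_nonneg sin_ge_zero)
      with B[OF z] solution_deriv[OF s] show "\<exists>d. (A has_real_derivative d) (at z) \<and> 0 \<le> d"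
        by (meson order_trans)
    qed
    with B[of y] y show ?thesis by simp
  qed
  have nn: "0 < A y" if y: "a \<le> y" "y \<le> b" for y
  proof (rule ccontr)
    assume "\<not> 0 < A y"
    then obtain T where T: "a < T" "T \<le> y" "- A T = 0" "\<And>x. a \<le> x \<Longrightarrow> x < T \<Longrightarrow> - A x < 0"
      using first_zero[of a y "\<lambda>x. - A x"] y Aa
      by (auto intro!: continuous_intros solution_continuous[OF s])
    have "0 \<le> A x" if "a \<le> x" "x \<le> T" for x
      using T(3) T(4)[of x] that by (cases "x = T") auto
    with main[of T] T y Aa show False by auto
  qed
  then show "A a \<le> A x" "m * sin (A x) \<le> B x"
    using main[OF x] x by (meson less_imp_le order_trans)+
qed

text \<open>
  Below \<open>pi/2\<close> the bound with \<open>m = sqrt lambda\<close> persists because \<open>V > lambda\<close> and \<open>cos A \<ge> 0\<close>.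
\<close>

lemma first_half_stays:
  assumes s: "solution A B" and Aa: "0 < A a" and init: "sqrt lambda * sin (A a) \<le> B a"
    and bnd: "\<And>x. a \<le> x \<Longrightarrow> x \<le> b \<Longrightarrow> A x \<le> pi / 2"
    and x: "a \<le> x" "x \<le> b"
  shows "A a \<le> A x" "sqrt lambda * sin (A x) \<le> B x" "0 < B x"
proof -
  have le_pi: "A y \<le> pi" if "a \<le> y" "y \<le> b" for y
    using bnd[OF that] pi_gt_zero by linarith
  have m_ok: "0 \<le> h y * sqrt lambda + (V y - (sqrt lambda)\<^sup>2) * cos (A y)"
    if y: "a \<le> y" "y \<le> b" "0 \<le> A y" for y
    using bnd[of y] y lambda V_gt[of y] h_pos[of y] cos_ge_zero[of "A y"]
    by (intro add_nonneg_nonneg mult_nonneg_nonneg) auto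
  have *: "A a \<le> A x \<and> sqrt lambda * sin (A x) \<le> B x"
    using slope_bound_stays[OF s _ Aa init le_pi m_ok x] lambda by auto
  then show "A a \<le> A x" "sqrt lambda * sin (A x) \<le> B x" by auto
  have "0 < sin (A x)" using * Aa bnd[OF x] pi_gt_zero by (intro sin_gt_zero) auto
  then show "0 < B x" using * lambda by (smt (verit) mult_pos_pos real_sqrt_gt_zero)
qed

section \<open>Outcomes of shooting\<close>

definition overshoots :: "real \<Rightarrow> (real \<Rightarrow> real) \<Rightarrow> (real \<Rightarrow> real) \<Rightarrow> bool" where
  "overshoots a A B \<longleftrightarrow> (\<exists>x\<ge>a. pi < A x \<and> (\<forall>u\<in>{a..x}. 0 < B u))"

text \<open>
  The slope is required to be negative, and \<open>A\<close> to stay strictly below \<open>pi\<close>, so that the property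
  survives small changes of the solution.
\<close>

definition turns_back :: "real \<Rightarrow> (real \<Rightarrow> real) \<Rightarrow> (real \<Rightarrow> real) \<Rightarrow> bool" where
  "turns_back a A B \<longleftrightarrow> (\<exists>x\<ge>a. B x < 0 \<and> (\<forall>u\<in>{a..x}. A u < pi))"

lemma not_overshoots_and_turns_back: "\<not> (overshoots a A B \<and> turns_back a A B)"
proof
  assume "overshoots a A B \<and> turns_back a A B"
  then obtain x w where "a \<le> x" "pi < A x" "\<forall>u\<in>{a..x}. 0 < B u" "a \<le> w" "B w < 0" "\<forall>u\<in>{a..w}. A u < pi"
    unfolding overshoots_def turns_back_def by blast
  then show False
    by (cases "x \<le> w") (force dest: bspec[of _ _ x] bspec[of _ _ w])+
qed

section \<open>Slow starts overshoot\<close>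

text \<open>
  As \<open>s\<close> tends to \<open>1\<close>, the anti-damping \<open>h\<close> tends to \<open>kappa > 0\<close> while \<open>mu - V\<close> tends to \<open>0\<close>.
\<close>

lemma drift_dominates:
  obtains c x0 where "c > 0" "\<And>x. x0 \<le> x \<Longrightarrow> c \<le> h x * sqrt lambda - (mu - V x)"
proof -
  define r where "r = kappa * sqrt lambda"
  have r: "r > 0" using kappa lambda by (simp add: r_def)
  define R where "R = r + (mu - lambda)"
  have R: "R > 0" using r lambda_less_mu by (simp add: R_def)
  obtain x0 where x0: "1 - (r / 2) / R < logistic x0"
    using exists_logistic_greater[of "1 - (r/2) / R"] r R by auto
  have "r / 2 \<le> h x * sqrt lambda - (mu - V x)" if "x0 \<le> x" for x
  proof -
    have "1 - logistic x \<le> (r / 2) / R" using x0 logistic_mono[OF that] by linarith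
    then have "R * (1 - logistic x) \<le> r / 2" using R by (simp add: field_simps)
    moreover have "h x * sqrt lambda - (mu - V x) = r - R * (1 - logistic x)"
      by (simp add: h_def V_def r_def R_def algebra_simps)
    ultimately show ?thesis by linarith
  qed
  with r show thesis by (intro that[of "r/2" x0]) auto
qed

text \<open>
  This is the condition of \<open>slope_bound_stays\<close> for \<open>m = sqrt mu\<close>: once it holds, slope ratios above
  \<open>sqrt mu\<close> persist, whatever the value of \<open>A\<close>.
\<close>

lemma steep_drift:
  assumes "0 \<le> h x * sqrt lambda - (mu - V x)"
  shows "0 \<le> h x * sqrt mu + (V x - (sqrt mu)\<^sup>2) * cos a"
proof -
  have "(mu - V x) * cos a \<le> (mu - V x) * 1"
    using V_le[of x] by (intro mult_left_mono) auto
  moreover have "h x * sqrt lambda \<le> h x * sqrt mu"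
    using h_pos[of x] lambda_less_mu by (intro mult_left_mono) auto
  ultimately have "0 \<le> h x * sqrt mu - (mu - V x) * cos a" using assms by simp
  also have "\<dots> = h x * sqrt mu + (V x - (sqrt mu)\<^sup>2) * cos a"
    using lambda lambda_less_mu by (simp add: algebra_simps)
  finally show ?thesis .
qed

text \<open>
  The ratio \<open>y\<close> stays above \<open>sqrt mu\<close>, so \<open>A\<close> passes \<open>pi/2\<close>. There \<open>cos A\<close> becomes nonpositive, and
  \<open>y\<^sup>2 \<ge> mu \<ge> V\<close> gives \<open>y' \<ge> h y\<close>, which is bounded below by a positive constant, so \<open>y\<close> tends to infinity. As soon as
  \<open>h y \<ge> mu\<close>, the anti-damping outweighs the restoring force and \<open>A'\<close> no longer decreases; then \<open>A\<close>
  cannot stay bounded.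
\<close>

lemma steep_solution_reaches_pi:
  assumes s: "solution A B" and drift: "\<And>x. a \<le> x \<Longrightarrow> 0 \<le> h x * sqrt lambda - (mu - V x)"
    and Aa: "0 < A a" and init: "sqrt mu * sin (A a) \<le> B a"
  shows "\<exists>x\<ge>a. pi \<le> A x"
proof (rule ccontr)
  assume "\<not> ?thesis"
  then have less: "A x < pi" if "a \<le> x" for x using that by force
  have mu0: "0 < mu" using lambda lambda_less_mu by simp
  note m_ok = steep_drift[OF drift]
  have st: "A a \<le> A x" "sqrt mu * sin (A x) \<le> B x" if "a \<le> x" for x
    using slope_bound_stays[OF s _ Aa init, of x x] less m_ok that mu0 by (auto intro: less_imp_le)
  have sp: "0 < sin (A x)" if "a \<le> x" for x
    using st(1)[OF that] Aa less[OF that] by (intro sin_gt_zero) auto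
  have Bp: "0 < B x" if "a \<le> x" for x
    using st(2)[OF that] sp[OF that] mu0 by (smt (verit) mult_pos_pos real_sqrt_gt_zero)
  have mono: "A x \<le> A y" if "a \<le> x" "x \<le> y" for x y
    by (rule DERIV_nonneg_imp_nondecreasing[OF that(2)])
       (use that Bp solution_deriv[OF s] in \<open>meson less_imp_le order_trans\<close>)
  have unbounded: False if d: "0 < d" "a \<le> b" and dB: "\<And>x. b \<le> x \<Longrightarrow> d \<le> B x" for b d
  proof -
    have "A b + d * ((b + pi / d) - b) \<le> A (b + pi / d)"
      by (rule derivative_lower_bound) (use d dB solution_deriv[OF s] in auto)
    moreover have "d * ((b + pi / d) - b) = pi" using d by simp
    moreover have "a \<le> b + pi / d" using d by (simp add: add_increasing2)
    ultimately show False using less[of "b + pi / d"] st(1)[OF d(2)] Aa by linarith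
  qed
  have "\<exists>b\<ge>a. pi / 2 < A b"
  proof (rule ccontr)
    assume "\<not> ?thesis"
    then have le: "A x \<le> pi / 2" if "a \<le> x" for x using that by force
    have "sqrt mu * sin (A a) \<le> B x" if "a \<le> x" for x
    proof -
      have "sin (A a) \<le> sin (A x)"
        using st(1)[OF that] le[OF that] Aa by (intro sin_monotone_2pi_le) auto
      then have "sqrt mu * sin (A a) \<le> sqrt mu * sin (A x)" using mu0 by (intro mult_left_mono) auto
      with st(2)[OF that] show ?thesis by linarith
    qed
    then show False using unbounded[of "sqrt mu * sin (A a)" a] mu0 sp[of a] by auto
  qed
  then obtain b where b: "a \<le> b" "pi / 2 < A b" by blast
  define y where "y x = B x / sin (A x)" for x
  have y_ge: "sqrt mu \<le> y x" if "a \<le> x" for x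
    using st(2)[OF that] sp[OF that] by (simp add: y_def field_simps)
  have cneg: "cos (A x) \<le> 0" if "b \<le> x" for x
    using b less[of x] mono[OF b(1) that] that cos_monotone_0_pi_le[of "pi/2" "A x"] by simp
  have h_mono: "h b \<le> h x" if "b \<le> x" for x
    using kappa logistic_mono[OF that] by (simp add: h_def)
  have y_growth: "y b + h b * sqrt mu * (x - b) \<le> y x" if x: "b \<le> x" for x
  proof (rule derivative_lower_bound[OF x])
    fix z assume z: "b \<le> z" "z \<le> x"
    show "(y has_real_derivative h z * y z + (V z - (y z)\<^sup>2) * cos (A z)) (at z)"
      using ratio_deriv[OF s, of z] sp[of z] z b by (simp add: y_def[abs_def])
    have "mu \<le> (y z)\<^sup>2"
      using y_ge[of z] z b mu0 power_mono[of "sqrt mu" "y z" 2] by simp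
    then have "0 \<le> (V z - (y z)\<^sup>2) * cos (A z)"
      using V_le[of z] cneg[OF z(1)] by (intro mult_nonpos_nonpos) auto
    moreover have "h b * sqrt mu \<le> h z * y z"
      using h_mono[OF z(1)] y_ge[of z] z b h_pos[of b] h_pos[of z] mu0 by (intro mult_mono) auto
    ultimately show "h b * sqrt mu \<le> h z * y z + (V z - (y z)\<^sup>2) * cos (A z)" by linarith
  qed
  define e where "e = h b * (h b * sqrt mu)"
  have e: "e > 0" using h_pos[of b] mu0 by (simp add: e_def)
  define b' where "b' = b + mu / e"
  have b': "b \<le> b'" using e mu0 by (simp add: b'_def)
  have Bd: "0 \<le> force x (A x) (B x)" if x: "b' \<le> x" for x
  proof -
    have xb: "b \<le> x" "a \<le> x" using x b' b by auto
    have "mu \<le> e * (x - b)" using x e by (simp add: b'_def field_simps)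
    also have "\<dots> = h b * (h b * sqrt mu * (x - b))" by (simp add: e_def)
    also have "\<dots> \<le> h b * y x"
    proof (rule mult_left_mono)
      have "0 < sqrt mu" using mu0 by simp
      then show "h b * sqrt mu * (x - b) \<le> y x" using y_growth[OF xb(1)] y_ge[OF b(1)] by linarith
    qed (use h_pos[of b] in simp)
    also have "\<dots> \<le> h x * y x"
      by (intro mult_right_mono)
        (use h_mono[OF xb(1)] y_ge[OF xb(2)] real_sqrt_gt_zero[OF mu0] in linarith)+
    finally have 1: "mu \<le> h x * y x" .
    have "V x * (- cos (A x)) \<le> V x * 1"
      using V_pos[of x] cos_ge_minus_one[of "A x"] by (intro mult_left_mono) (auto simp: algebra_simps)
    then have "0 \<le> h x * y x + V x * cos (A x)" using 1 V_le[of x] by simp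
    moreover have "force x (A x) (B x) = sin (A x) * (h x * y x + V x * cos (A x))"
      using sp[OF xb(2)] by (simp add: force_def y_def field_simps)
    ultimately show ?thesis using sp[OF xb(2)] by simp
  qed
  have "B b' \<le> B x" if "b' \<le> x" for x
    by (rule DERIV_nonneg_imp_nondecreasing[OF that]) (use Bd solution_deriv[OF s] in blast)
  then show False using unbounded[of "B b'" b'] Bp[of b'] b' b by auto
qed

lemma crossing_overshoots:
  assumes s: "solution A B" and aT: "a \<le> T" and T: "A T = pi" and B: "\<And>u. a \<le> u \<Longrightarrow> u < T \<Longrightarrow> 0 < B u"
    and T': "0 < B T"
  shows "overshoots a A B"
proof -
  have "isCont B T" using solution_deriv[OF s] DERIV_isCont by blast
  then have "eventually (\<lambda>u. 0 < B u) (nhds T)"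
    using T' order_tendstoD(1)[of B "B T" "nhds T" 0] by (simp add: tendsto_at_iff_tendsto_nhds isCont_def)
  then obtain d where d: "d > 0" "\<And>u. dist u T < d \<Longrightarrow> 0 < B u"
    by (auto simp: eventually_nhds_metric)
  have pos: "0 < B u" if "a \<le> u" "u \<le> T + d / 2" for u
    using B[of u] d(2)[of u] d(1) that by (cases "u < T") (auto simp: dist_real_def)
  have "A T < A (T + d / 2)"
  proof (rule DERIV_pos_imp_increasing[where f = A])
    fix u assume "T \<le> u" "u \<le> T + d / 2"
    then show "\<exists>y. (A has_real_derivative y) (at u) \<and> 0 < y"
      using pos[of u] aT solution_deriv(1)[OF s, of u] by auto
  qed (use d in simp)
  then show ?thesis
    unfolding overshoots_def using T d aT pos by (intro exI[of _ "T + d/2"]) auto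
qed

text \<open>
  On \<open>[x0, X]\<close> the ratio \<open>y\<close> is at least \<open>sqrt lambda\<close>, and as long as it is below \<open>sqrt mu\<close> it increases
  at a rate of at least \<open>c\<close>. The length of the interval is chosen such that it must reach \<open>sqrt mu\<close>.
\<close>

lemma slow_start_overshoots:
  obtains x0 X where "x0 \<le> X" "\<And>A B a. solution A B \<Longrightarrow> a \<le> x0 \<Longrightarrow> 0 < A a \<Longrightarrow> sqrt lambda * sin (A a) \<le> B a
     \<Longrightarrow> \<forall>x\<in>{a..X}. A x \<le> pi / 2 \<Longrightarrow> overshoots a A B"
proof -
  obtain c x0 where c: "c > 0" and drift: "\<And>x. x0 \<le> x \<Longrightarrow> c \<le> h x * sqrt lambda - (mu - V x)"
    using drift_dominates by blast
  have mu0: "0 < mu" using lambda lambda_less_mu by simp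
  \<comment> \<open>At rate \<open>c\<close>, the ratio \<open>y\<close> gains \<open>sqrt mu\<close> on \<open>[x0, X]\<close>.\<close>
  define X where "X = x0 + sqrt mu / c"
  have X: "x0 \<le> X" using c mu0 by (simp add: X_def)
  have "overshoots a A B" if s: "solution A B" and a: "a \<le> x0" and Aa: "0 < A a"
    and init: "sqrt lambda * sin (A a) \<le> B a" and low0: "\<forall>x\<in>{a..X}. A x \<le> pi / 2" for A B a
  proof -
    have low: "A x \<le> pi / 2" if "a \<le> x" "x \<le> X" for x using low0 that by simp
    note half = first_half_stays[OF s Aa init low]
    have sp: "0 < sin (A x)" if "a \<le> x" "x \<le> X" for x
      using half(1)[of X x] low[of x] Aa that pi_gt_zero by (intro sin_gt_zero) auto
    define y where "y x = B x / sin (A x)" for x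
    have y_low: "sqrt lambda \<le> y x" if "a \<le> x" "x \<le> X" for x
      using half(2)[of X x] sp[of x] that by (simp add: y_def field_simps)
    have "\<exists>b\<ge>x0. b \<le> X \<and> sqrt mu * sin (A b) \<le> B b"
    proof (rule ccontr)
      assume neg: "\<not> ?thesis"
      have y_up: "y x < sqrt mu" if "x0 \<le> x" "x \<le> X" for x
        using neg sp[of x] that a by (force simp: y_def field_simps)
      have "y x0 + c * (X - x0) \<le> y X"
      proof (rule derivative_lower_bound[OF X])
        fix x assume x: "x0 \<le> x" "x \<le> X"
        show "(y has_real_derivative h x * y x + (V x - (y x)\<^sup>2) * cos (A x)) (at x)"
          using ratio_deriv[OF s, of x] sp[of x] x a by (simp add: y_def[abs_def])
        have cosA: "0 \<le> cos (A x)" "cos (A x) \<le> 1"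
          using half(1)[of X x] low[of x] Aa x a by (auto intro!: cos_ge_zero)
        have "(y x)\<^sup>2 \<le> (sqrt mu)\<^sup>2"
          using y_up[OF x] y_low[of x] x a lambda by (intro power_mono) (auto intro: order_trans[of 0 "sqrt lambda"])
        then have "- (V x - (y x)\<^sup>2) \<le> mu - V x" using mu0 by simp
        moreover have "0 \<le> mu - V x" using V_le[of x] by simp
        ultimately have "- (V x - (y x)\<^sup>2) * cos (A x) \<le> (mu - V x) * 1"
          using cosA by (intro mult_mono) auto
        moreover have "h x * sqrt lambda \<le> h x * y x"
          using y_low[of x] x a h_pos[of x] by (intro mult_left_mono) auto
        ultimately show "c \<le> h x * y x + (V x - (y x)\<^sup>2) * cos (A x)"
          using drift[OF x(1)] by (simp add: left_diff_distrib)
      qed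
      then have "sqrt lambda + sqrt mu \<le> y X" using y_low[of x0] a X c by (simp add: X_def)
      moreover have "0 < sqrt lambda" using lambda by simp
      ultimately show False using y_up[of X] X by linarith
    qed
    then obtain b where b: "x0 \<le> b" "b \<le> X" "sqrt mu * sin (A b) \<le> B b" by blast
    have ab: "a \<le> b" using a b by simp
    have Ab: "0 < A b" using half(1)[of X b] Aa b ab by simp
    have drift0: "0 \<le> h x * sqrt lambda - (mu - V x)" if "b \<le> x" for x
      using drift[of x] that b c by simp
    obtain x1 where x1: "b \<le> x1" "pi \<le> A x1"
      using steep_solution_reaches_pi[OF s drift0 Ab b(3)] by blast
    have Ab_pi: "A b < pi" using low[of b] b ab pi_gt_zero by linarith
    have "continuous_on {b..x1} (\<lambda>x. A x - pi)" "A b - pi < 0" "0 \<le> A x1 - pi"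
      using x1 Ab_pi by (auto intro!: continuous_intros solution_continuous[OF s])
    then obtain T where T: "b < T" "T \<le> x1" "A T - pi = 0" "\<And>x. b \<le> x \<Longrightarrow> x < T \<Longrightarrow> A x - pi < 0"
      using first_zero[of b x1 "\<lambda>x. A x - pi"] x1 by blast
    have le_pi: "A x \<le> pi" if "b \<le> x" "x \<le> T" for x
      using T(3) T(4)[of x] that by (cases "x = T") auto
    note m_ok = steep_drift[OF drift0]
    have st: "A b \<le> A x" "sqrt mu * sin (A x) \<le> B x" if "b \<le> x" "x \<le> T" for x
      using slope_bound_stays[OF s _ Ab b(3) le_pi m_ok that] mu0 by auto
    show ?thesis
    proof (rule crossing_overshoots[OF s])
      show "a \<le> T" "A T = pi" using T ab by auto
      show "0 < B u" if u: "a \<le> u" "u < T" for u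
      proof (cases "u \<le> b")
        case True then show ?thesis using half(3)[of X u] u b by simp
      next
        case False
        then have "0 < sin (A u)" using st(1)[of u] T(4)[of u] u Ab by (intro sin_gt_zero) auto
        then show ?thesis using st(2)[of u] False u mu0 by (smt (verit) mult_pos_pos real_sqrt_gt_zero)
      qed
      have "B T \<noteq> 0"
        using equilibrium_unique[OF s, of pi T b] T Ab_pi by auto
      moreover have "0 \<le> B T" using st(2)[of T] T by auto
      ultimately show "0 < B T" by simp
    qed
  qed
  with X show thesis by (rule that)
qed

section \<open>Early rises turn back\<close>

definition surplus :: real where "surplus = mu - lambda - lambda * kappa"

lemma surplus_pos: "0 < surplus"
  using mu by (simp add: surplus_def)

text \<open>
  Two smallness conditions on \<open>s\<close>. The first one makes \<open>V' - 2 h V\<close> at least \<open>surplus * s\<close>. By the second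
  one the anti-damping contributes at most \<open>1 / (8 sqrt mu)\<close> to \<open>y'\<close>, half of the amount by which \<open>y\<close>
  is pulled down at the end of the proof of \<open>early_rise_turns_back\<close>.
\<close>

definition early :: "real \<Rightarrow> bool" where
  "early x \<longleftrightarrow> logistic x * ((mu - lambda) * (1 + kappa)) \<le> surplus / 2 \<and> h x \<le> 1 / (8 * mu)"

lemma early_mono: "early y" if "early x" "y \<le> x"
proof -
  have "logistic y * ((mu - lambda) * (1 + kappa)) \<le> logistic x * ((mu - lambda) * (1 + kappa))"
    using logistic_mono[OF that(2)] lambda_less_mu kappa by (intro mult_right_mono) auto
  moreover have "h y \<le> h x" using logistic_mono[OF that(2)] kappa by (simp add: h_def)
  ultimately show ?thesis using that(1) by (auto simp: early_def)
qed

lemma early_exists: obtains x where "early x"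
proof -
  define P where "P = (mu - lambda) * (1 + kappa)"
  have P: "P > 0" using lambda_less_mu kappa by (simp add: P_def)
  have mu0: "mu > 0" using lambda lambda_less_mu by simp
  obtain x where x: "logistic x < min (surplus / 2 / P) (1 / (8 * mu) / kappa)"
    using exists_logistic_less[of "min (surplus / 2 / P) (1 / (8 * mu) / kappa)"] surplus_pos P mu0 kappa by auto
  then have "logistic x * P \<le> surplus / 2" "h x \<le> 1 / (8 * mu)"
    using pos_less_divide_eq[OF P, of "logistic x" "surplus / 2"]
      pos_less_divide_eq[OF kappa, of "logistic x" "1 / (8 * mu)"]
    by (auto simp: h_def mult.commute)
  then show thesis by (intro that) (simp add: early_def P_def)
qed

text \<open>
  The right hand side is the derivative of \<open>V\<close>. To first order in \<open>s\<close> it exceeds \<open>2 h V\<close> by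
  \<open>2 (mu - lambda - lambda kappa) s = 2 * surplus * s\<close>; half of this survives the quadratic terms.
\<close>

lemma early_surplus:
  assumes "early x"
  shows "surplus * logistic x + 2 * h x * V x \<le> 2 * (mu - lambda) * logistic x * (1 - logistic x)"
proof -
  have "2 * (mu - lambda) * logistic x * (1 - logistic x) - 2 * h x * V x
    = 2 * logistic x * (surplus - logistic x * ((mu - lambda) * (1 + kappa)))"
    by (simp add: h_def V_def surplus_def algebra_simps)
  also have "\<dots> \<ge> 2 * logistic x * (surplus / 2)"
    using assms logistic_pos[of x] by (intro mult_left_mono) (auto simp: early_def)
  finally show ?thesis by (simp add: mult.commute)
qed

text \<open>
  For \<open>u = V sin\<^sup>2 A - A'\<^sup>2\<close> the terms with \<open>sin A cos A\<close> cancel and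
  \<open>u' = 2 h u + (V' - 2 h V) sin\<^sup>2 A \<ge> 2 h u\<close>.
\<close>

lemma energy_stays_nonpos:
  assumes s: "solution A B" and ab: "a \<le> b" and e: "early b"
    and init: "(B a)\<^sup>2 \<le> V a * (sin (A a))\<^sup>2"
  shows "(B b)\<^sup>2 \<le> V b * (sin (A b))\<^sup>2"
proof -
  define u where "u x = V x * (sin (A x))\<^sup>2 - (B x)\<^sup>2" for x
  define dV where "dV x = 2 * (mu - lambda) * logistic x * (1 - logistic x)" for x
  have u: "(u has_real_derivative dV x * (sin (A x))\<^sup>2 - 2 * h x * (B x)\<^sup>2) (at x)" for x
    unfolding u_def
    by (auto intro!: derivative_eq_intros solution_deriv[OF s] V_deriv
        simp: dV_def force_def algebra_simps power2_eq_square)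
  have "0 \<le> u b"
  proof (rule linear_differential_inequality[where p = "\<lambda>x. 2 * h x", OF ab _ u])
    show "continuous_on UNIV (\<lambda>x. 2 * h x)" by (intro continuous_intros continuous_on_h)
    show "0 \<le> u a" using init by (simp add: u_def)
    fix x assume x: "a \<le> x" "x \<le> b"
    have "2 * h x * V x \<le> dV x"
      using early_surplus[OF early_mono[OF e x(2)]] mult_pos_pos[OF surplus_pos logistic_pos[of x]]
      unfolding dV_def by linarith
    then have "2 * h x * V x * (sin (A x))\<^sup>2 \<le> dV x * (sin (A x))\<^sup>2"
      by (rule mult_right_mono) simp
    then show "2 * h x * u x \<le> dV x * (sin (A x))\<^sup>2 - 2 * h x * (B x)\<^sup>2"
      by (simp add: u_def algebra_simps)
  qed
  then show ?thesis by (simp add: u_def)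
qed

text \<open>
  At \<open>0\<close> or \<open>pi\<close> nonpositive energy means zero speed, that is, a rest point.
\<close>

lemma early_confinement:
  assumes s: "solution A B" and ab: "a \<le> b" and e: "early b"
    and init: "(B a)\<^sup>2 \<le> V a * (sin (A a))\<^sup>2" and Aa: "0 < A a" "A a < pi"
  shows "0 < A b" "A b < pi"
proof -
  have no: "A x \<noteq> c" if x: "a \<le> x" "x \<le> b" and c: "c = 0 \<or> c = pi" for x c
  proof
    assume "A x = c"
    moreover have "(B x)\<^sup>2 \<le> V x * (sin (A x))\<^sup>2"
      by (rule energy_stays_nonpos[OF s x(1) early_mono[OF e x(2)] init])
    ultimately have "B x = 0" using c by auto
    then show False using equilibrium_unique[OF s _ \<open>A x = c\<close>, of a] c Aa by auto
  qed
  have cont: "continuous_on {a..b} A" by (rule solution_continuous[OF s])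
  show "0 < A b" using IVT2'[of A b 0 a] no[of _ 0] Aa ab cont by force
  show "A b < pi" using IVT'[of A a pi b] no[of _ pi] Aa ab cont by force
qed

text \<open>
  The slope \<open>sqrt lambda sin A\<close> serves both sides: it is large enough for \<open>first_half_stays\<close>, and
  because of \<open>lambda < V\<close> it is small enough for the energy to be nonpositive.
\<close>

lemma initial_energy_nonpos:
  assumes "B = sqrt lambda * sin A"
  shows "B\<^sup>2 \<le> V a * (sin A)\<^sup>2"
  using assms lambda V_gt[of a] by (auto simp: power_mult_distrib intro!: mult_right_mono)

text \<open>
  Suppose the solution keeps rising up to \<open>x1\<close>, and let \<open>x0 \<le> M\<close> be the point where it passes \<open>pi/2\<close>.
  The proof follows \<open>t = - cos A\<close>, the slope ratio \<open>y\<close> and the defect \<open>z = V - y\<^sup>2\<close>, which satisfy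
  \<open>t' = sin A * A'\<close>, \<open>y' = h y - z t\<close> and \<open>z' \<ge> surplus * s + 2 y t z\<close>.

  First, \<open>t\<close> reaches \<open>1 / (2 sqrt mu)\<close> within one unit of time (\<open>t_big\<close>), because \<open>A'\<^sup>2 + V cos\<^sup>2 A\<close> is
  nondecreasing and so \<open>A'\<close> cannot be small near \<open>pi/2\<close>. Second, \<open>z\<close> reaches \<open>1/2\<close> before \<open>xK\<close> (\<open>zK\<close>):
  otherwise \<open>z / s\<close>, up to a bounded factor, would grow linearly from \<open>x0\<close> to \<open>xK\<close>, and \<open>M\<close> is chosen
  so far to the left of \<open>xK\<close> that this is a contradiction. Third, on the remaining interval from \<open>xK\<close> to
  \<open>x1\<close>, which is long enough, \<open>y\<close> decreases at a fixed rate from at most \<open>sqrt mu\<close> to below zero.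
\<close>

lemma early_rise_turns_back:
  assumes x1: "early x1"
  obtains M where "M \<le> x1" "\<And>A B a. solution A B \<Longrightarrow> a \<le> M \<Longrightarrow> 0 < A a \<Longrightarrow> A a \<le> pi / 2
    \<Longrightarrow> B a = sqrt lambda * sin (A a) \<Longrightarrow> pi / 2 \<le> A M \<Longrightarrow> turns_back a A B"
proof -
  define r where "r = sqrt mu"
  have mu1: "1 < mu" using lambda lambda_less_mu by simp
  have r2: "r\<^sup>2 = mu" and r1: "1 < r" using mu1 by (auto simp: r_def)
  \<comment> \<open>From \<open>xK\<close> on, \<open>y\<close> falls at rate \<open>1 / (8 r)\<close>; the length \<open>8 * mu + 1\<close> makes it lose more than \<open>r\<close>.\<close>
  define xK where "xK = x1 - (8 * mu + 1)"
  have xK: "xK \<le> x1" using mu1 by (simp add: xK_def)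
  define d where "d = surplus * exp (- 6)"
  have d: "d > 0" using surplus_pos by (simp add: d_def)
  \<comment> \<open>The function \<open>F\<close> below grows at rate \<open>d\<close> but is less than \<open>D * d\<close> at \<open>xK\<close> if \<open>z < 1/2\<close> there.\<close>
  define D where "D = exp 1 / (2 * logistic xK * d)"
  have D: "D > 0" using d logistic_pos[of xK] by (simp add: D_def)
  \<comment> \<open>The summand \<open>1\<close> leaves the unit of time in which \<open>t\<close> reaches \<open>1 / (2 * r)\<close>.\<close>
  define M where "M = xK - 1 - D"
  have M: "M + 1 \<le> xK" using D by (simp add: M_def)
  have "turns_back a A B" if s: "solution A B" and aM: "a \<le> M" and Aa: "0 < A a" "A a \<le> pi / 2"
    and Ba: "B a = sqrt lambda * sin (A a)" and AM: "pi / 2 \<le> A M" for A B a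
  proof (rule ccontr)
    assume nt: "\<not> turns_back a A B"
    note E0 = initial_energy_nonpos[OF Ba, of a]
    have Aa_pi: "A a < pi" using Aa pi_gt_zero by linarith
    have A01: "0 < A x" "A x < pi" if "a \<le> x" "x \<le> x1" for x
      using early_confinement[OF s that(1) early_mono[OF x1 that(2)] E0 Aa(1) Aa_pi] by auto
    have sp: "0 < sin (A x)" if "a \<le> x" "x \<le> x1" for x
      using A01[OF that] by (intro sin_gt_zero) auto
    have Bn: "0 \<le> B x" if "a \<le> x" "x \<le> x1" for x
      using nt A01(2) that unfolding turns_back_def by (metis atLeastAtMost_iff linorder_not_le order_trans)
    have mono: "A x \<le> A y" if "a \<le> x" "x \<le> y" "y \<le> x1" for x y
      by (rule DERIV_nonneg_imp_nondecreasing[OF that(2)])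
         (use that Bn solution_deriv[OF s] in \<open>meson order_trans\<close>)
    obtain x0 where x0: "a \<le> x0" "x0 \<le> M" "A x0 = pi / 2"
      using IVT'[of A a "pi/2" M] Aa AM aM solution_continuous[OF s] by blast
    have x0_xK: "x0 + 1 \<le> xK" and ax: "a \<le> x" if "x0 \<le> x" for x using x0 M that by auto
    have x0x1: "x0 \<le> x1" using x0_xK[of x0] xK by simp
    have cosn: "cos (A x) \<le> 0" if "x0 \<le> x" "x \<le> x1" for x
      using mono[OF x0(1) that] A01[OF ax[OF that(1)] that(2)] x0(3) cos_monotone_0_pi_le[of "pi/2" "A x"] by simp
    have B0: "sqrt lambda \<le> B x0"
    proof -
      have "A x \<le> pi / 2" if "a \<le> x" "x \<le> x0" for x
        using mono[of x x0] that x0 x0x1 by simp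
      then have "sqrt lambda * sin (A x0) \<le> B x0"
        using first_half_stays(2)[OF s Aa(1), of x0 x0] Ba x0(1) by simp
      then show ?thesis by (simp only: x0(3) sin_pi_half mult_1_right)
    qed
    define t where "t x = - cos (A x)" for x
    have t01: "0 \<le> t x" "t x < 1" if "x0 \<le> x" "x \<le> x1" for x
      using cosn[OF that] cos_monotone_0_pi[of "A x" pi] A01[OF ax[OF that(1)] that(2)] by (auto simp: t_def)
    have t_deriv: "(t has_real_derivative sin (A x) * B x) (at x)" for x
      unfolding t_def by (auto intro!: derivative_eq_intros solution_deriv[OF s])
    have t_mono: "t x \<le> t y" if "x0 \<le> x" "x \<le> y" "y \<le> x1" for x y
    proof (rule DERIV_nonneg_imp_nondecreasing[OF that(2)])
      fix z assume "x \<le> z" "z \<le> y"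
      then have "a \<le> z" "z \<le> x1" using that x0 by auto
      then have "0 \<le> sin (A z) * B z" using sp[of z] Bn[of z] by simp
      then show "\<exists>d. (t has_real_derivative d) (at z) \<and> 0 \<le> d" using t_deriv by blast
    qed
    have t_big: "1 / (2 * r) \<le> t x" if x: "x0 + 1 \<le> x" "x \<le> x1" for x
    proof (rule ccontr)
      assume neg: "\<not> 1 / (2 * r) \<le> t x"
      have half: "1 / (2 * r) \<le> 1 / 2" using r1 by (simp add: field_simps)
      have "t x0 + 3 / 4 * ((x0 + 1) - x0) \<le> t (x0 + 1)"
      proof (rule derivative_lower_bound[OF _ t_deriv])
        fix z assume z: "x0 \<le> z" "z \<le> x0 + 1"
        have zx1: "z \<le> x1" "a \<le> z" using z x x0 by auto
        have tz: "t z \<le> 1 / (2 * r)" using t_mono[of z x] neg z x by simp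
        \<comment> \<open>Its derivative \<open>2 h A'\<^sup>2 + V' cos\<^sup>2 A\<close> is nonnegative, and it is at least \<open>lambda \<ge> 1\<close> at \<open>x0\<close>.\<close>
        define Q where "Q x = (B x)\<^sup>2 + V x * (cos (A x))\<^sup>2" for x
        have Q: "(Q has_real_derivative 2 * h w * (B w)\<^sup>2
            + 2 * (mu - lambda) * logistic w * (1 - logistic w) * (cos (A w))\<^sup>2) (at w)" for w
          unfolding Q_def
          by (auto intro!: derivative_eq_intros solution_deriv[OF s] V_deriv
              simp: force_def algebra_simps power2_eq_square)
        have "Q x0 \<le> Q z"
        proof (rule DERIV_nonneg_imp_nondecreasing[OF z(1)])
          fix w
          have "0 \<le> 2 * h w * (B w)\<^sup>2 + 2 * (mu - lambda) * logistic w * (1 - logistic w) * (cos (A w))\<^sup>2"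
            using h_pos[of w] lambda_less_mu logistic_pos[of w] logistic_less_1[of w] by simp
          then show "\<exists>d. (Q has_real_derivative d) (at w) \<and> 0 \<le> d" using Q by blast
        qed
        moreover have "1 \<le> Q x0"
        proof -
          have "1\<^sup>2 \<le> (sqrt lambda)\<^sup>2" using lambda by simp
          also have "\<dots> \<le> (B x0)\<^sup>2" using B0 lambda by (intro power_mono) auto
          finally show ?thesis by (simp add: Q_def x0(3))
        qed
        moreover have "V z * (t z)\<^sup>2 \<le> 1 / 4"
        proof -
          have "V z * (t z)\<^sup>2 \<le> mu * (1 / (2 * r))\<^sup>2"
            using V_le[of z] V_pos[of z] t01[OF z(1) zx1(1)] tz by (intro mult_mono power_mono) auto
          also have "\<dots> = 1 / 4" using r2 r1 mu1 by (simp add: power2_eq_square field_simps)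
          finally show ?thesis .
        qed
        ultimately have B2: "3 / 4 \<le> (B z)\<^sup>2" by (simp add: Q_def t_def)
        have "(t z)\<^sup>2 \<le> (1 / 2)\<^sup>2" using t01[OF z(1) zx1(1)] tz half by (intro power_mono) auto
        then have S2: "3 / 4 \<le> (sin (A z))\<^sup>2"
          using sin_cos_squared_add[of "A z"] by (simp add: t_def power2_eq_square)
        have "(3 / 4)\<^sup>2 \<le> (sin (A z) * B z)\<^sup>2"
          using mult_mono[OF S2 B2] by (simp add: power2_eq_square mult_ac)
        then show "3 / 4 \<le> sin (A z) * B z"
          by (rule power2_le_imp_le) (use sp[OF zx1(2,1)] Bn[OF zx1(2,1)] in simp)
      qed simp
      moreover have "t x0 = 0" by (simp add: t_def x0(3))
      moreover have "t (x0 + 1) \<le> t x" using x by (intro t_mono) auto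
      ultimately have "3 / 4 \<le> t x" by simp
      moreover have "t x < 1 / 2" using neg half by (meson less_le_trans not_le)
      ultimately show False by simp
    qed
    define y where "y x = B x / sin (A x)" for x
    define z where "z x = V x - (y x)\<^sup>2" for x
    have Bsy: "B x = y x * sin (A x)" if "a \<le> x" "x \<le> x1" for x
      using sp[OF that] by (simp add: y_def)
    have yn: "0 \<le> y x" if "a \<le> x" "x \<le> x1" for x
      using sp[OF that] Bn[OF that] by (simp add: y_def)
    have zn: "0 \<le> z x" if "a \<le> x" "x \<le> x1" for x
    proof -
      have "(y x)\<^sup>2 * (sin (A x))\<^sup>2 \<le> V x * (sin (A x))\<^sup>2"
        using energy_stays_nonpos[OF s that(1) early_mono[OF x1 that(2)] E0] Bsy[OF that]
        by (simp add: power_mult_distrib)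
      then show ?thesis using sp[OF that] by (simp add: z_def)
    qed
    have yr: "y x \<le> r" if "a \<le> x" "x \<le> x1" for x
    proof -
      have "(y x)\<^sup>2 \<le> r\<^sup>2" using zn[OF that] V_le[of x] by (simp add: z_def r2)
      then show ?thesis by (rule power2_le_imp_le) (use r1 in simp)
    qed
    have y_deriv: "(y has_real_derivative h x * y x - z x * t x) (at x)" if "a \<le> x" "x \<le> x1" for x
      using ratio_deriv[OF s, of x] sp[OF that] by (simp add: y_def[abs_def] z_def t_def)
    define z' where "z' x = 2 * (mu - lambda) * logistic x * (1 - logistic x)
      - 2 * y x * (h x * y x - z x * t x)" for x
    have z_deriv: "(z has_real_derivative z' x) (at x)" if "a \<le> x" "x \<le> x1" for x
      unfolding z_def z'_def by (auto intro!: derivative_eq_intros V_deriv y_deriv[OF that] simp: z_def)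
    have z'_ge: "surplus * logistic x + 2 * y x * t x * z x \<le> z' x" if "a \<le> x" "x \<le> x1" for x
    proof -
      have "0 \<le> 2 * h x * z x" using h_pos[of x] zn[OF that] by simp
      moreover have "2 * h x * z x = 2 * h x * V x - 2 * y x * (h x * y x)"
        by (simp add: z_def algebra_simps power2_eq_square)
      moreover have "z' x = 2 * (mu - lambda) * logistic x * (1 - logistic x) - 2 * y x * (h x * y x)
          + 2 * y x * t x * z x"
        by (simp add: z'_def algebra_simps)
      ultimately show ?thesis using early_surplus[OF early_mono[OF x1 that(2)]] by linarith
    qed
    have z_mono: "z x \<le> z w" if "x0 \<le> x" "x \<le> w" "w \<le> x1" for x w
    proof (rule DERIV_nonneg_imp_nondecreasing[OF that(2)])
      fix v assume "x \<le> v" "v \<le> w"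
      then have v: "x0 \<le> v" "a \<le> v" "v \<le> x1" using that x0 by auto
      have "0 \<le> surplus * logistic v + 2 * y v * t v * z v"
        using surplus_pos logistic_pos[of v] yn[OF v(2,3)] t01[OF v(1,3)] zn[OF v(2,3)] by simp
      then have "0 \<le> z' v" using z'_ge[OF v(2,3)] by linarith
      then show "\<exists>d. (z has_real_derivative d) (at v) \<and> 0 \<le> d" using z_deriv[OF v(2,3)] by blast
    qed
    have zK: "1 / 2 \<le> z xK"
    proof (rule ccontr)
      assume neg: "\<not> 1 / 2 \<le> z xK"
      \<comment> \<open>The logarithmic derivative of \<open>z / s\<close> is, apart from the feeding term, at least \<open>2 y t - 2 (1 - s)\<close>, and
        \<open>y t \<ge> 1 - z - p\<close> with \<open>p = 1 - t\<close>. The exponential absorbs the losses \<open>- 2 z\<close> and \<open>- 2 p\<close>: both \<open>z\<close>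
        and \<open>p\<close> change so fast (\<open>z' \<ge> (1 - p) z\<close> and \<open>- p' \<ge> p / 2\<close>) that their integrals are bounded.\<close>
      define F where "F x = z x / logistic x * exp (2 * z x - 6 * (1 - t x))" for x
      have "F x0 + d * (xK - x0) \<le> F xK"
      proof (rule derivative_lower_bound)
        show "x0 \<le> xK" using x0_xK[of x0] by simp
        fix x assume x: "x0 \<le> x" "x \<le> xK"
        have ax: "a \<le> x" "x \<le> x1" using x x0 xK by auto
        define l e G where "l = logistic x" and "e = exp (2 * z x - 6 * (1 - t x))"
          and "G = z' x - 2 * (1 - l) * z x + z x * (2 * z' x + 6 * (sin (A x) * B x))"
        have l: "0 < l" "l < 1" using logistic_pos[of x] logistic_less_1[of x] by (auto simp: l_def)
        show "(F has_real_derivative G / l * e) (at x)"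
        proof -
          have 1: "((\<lambda>x. z x / logistic x) has_real_derivative (z' x * l - z x * (2 * l * (1 - l))) / (l * l)) (at x)"
            unfolding l_def by (rule DERIV_divide z_deriv[OF ax] logistic_deriv)+ (use l in \<open>simp add: l_def\<close>)
          have 2: "((\<lambda>x. exp (2 * z x - 6 * (1 - t x))) has_real_derivative
              (2 * z' x + 6 * (sin (A x) * B x)) * e) (at x)"
            unfolding e_def by (auto intro!: derivative_eq_intros z_deriv[OF ax] t_deriv)
          have "(z' x * l - z x * (2 * l * (1 - l))) / (l * l) * e
              + (2 * z' x + 6 * (sin (A x) * B x)) * e * (z x / l) = G / l * e"
            using l by (simp add: G_def field_simps)
          then show ?thesis
            using DERIV_mult[OF 1 2] unfolding F_def l_def[symmetric] e_def[symmetric] by simp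
        qed
        define p where "p = 1 - t x"
        have p: "0 < p" "p \<le> 1" using t01[OF x(1) ax(2)] by (auto simp: p_def)
        have z0: "0 \<le> z x" "z x < 1 / 2" using zn[OF ax] z_mono[OF x xK] neg by auto
        \<comment> \<open>Here \<open>V \<ge> lambda \<ge> 1\<close> enters: \<open>y\<^sup>2 = V - z \<ge> 1 - z \<ge> (1 - z)\<^sup>2\<close>.\<close>
        have y1: "1 - z x \<le> y x"
        proof (rule power2_le_imp_le)
          have "(1 - z x)\<^sup>2 \<le> 1 - z x" using z0 by (simp add: power2_eq_square mult_left_le)
          also have "\<dots> \<le> (y x)\<^sup>2" using V_gt[of x] lambda by (simp add: z_def)
          finally show "(1 - z x)\<^sup>2 \<le> (y x)\<^sup>2" .
        qed (rule yn[OF ax])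
        have sB: "p / 2 \<le> sin (A x) * B x"
        proof -
          have "sin (A x) * B x = y x * (1 - (t x)\<^sup>2)"
            using Bsy[OF ax] by (simp add: t_def cos_squared_eq) (simp add: power2_eq_square)
          also have "1 - (t x)\<^sup>2 = p * (1 + t x)" by (simp add: p_def power2_eq_square algebra_simps)
          finally have eq: "sin (A x) * B x = y x * (p * (1 + t x))" .
          have "1 / 2 * (p * 1) \<le> y x * (p * (1 + t x))"
            using y1 z0 p t01[OF x(1) ax(2)] by (intro mult_mono) auto
          then show ?thesis using eq by simp
        qed
        have yt: "1 - z x - p \<le> y x * t x"
        proof -
          have "(1 - z x) * t x \<le> y x * t x" using y1 t01[OF x(1) ax(2)] by (intro mult_right_mono) auto
          moreover have "(1 - z x) * t x = 1 - z x - p + z x * p" by (simp add: p_def algebra_simps)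
          moreover have "0 \<le> z x * p" using z0 p by simp
          ultimately show ?thesis by linarith
        qed
        have yt': "(1 - p) / 2 \<le> y x * t x"
        proof -
          have "1 / 2 * t x \<le> y x * t x" using y1 z0 t01[OF x(1) ax(2)] by (intro mult_right_mono) auto
          then show ?thesis by (simp add: p_def)
        qed
        have "surplus * l + 2 * y x * t x * z x \<le> z' x" using z'_ge[OF ax] by (simp add: l_def)
        moreover have sl: "0 \<le> surplus * l" using surplus_pos l by simp
        moreover have "(1 - p) * z x \<le> 2 * y x * t x * z x"
          using mult_right_mono[OF yt' z0(1)] by (simp add: algebra_simps)
        ultimately have z'2: "(1 - p) * z x \<le> z' x" by linarith
        have "p * z x \<le> p * (1 / 2)" using z0 p by (intro mult_left_mono) auto
        then have "0 \<le> 2 * (y x * t x) - 2 * (1 - l) + 2 * z' x + 6 * (sin (A x) * B x)"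
          using yt z'2 sB l by (simp add: algebra_simps)
        then have "0 \<le> z x * (2 * (y x * t x) - 2 * (1 - l) + 2 * z' x + 6 * (sin (A x) * B x))"
          using z0 by simp
        moreover have "G = (z' x - 2 * y x * t x * z x) + z x * (2 * (y x * t x) - 2 * (1 - l) + 2 * z' x + 6 * (sin (A x) * B x))"
          by (simp add: G_def algebra_simps)
        ultimately have "surplus * l \<le> G" using z'_ge[OF ax] by (simp add: l_def)
        then have G: "surplus \<le> G / l" using l by (simp add: field_simps)
        have "exp (- 6) \<le> e" using z0 p by (simp add: e_def p_def)
        then show "d \<le> G / l * e"
          unfolding d_def using G surplus_pos by (intro mult_mono) auto
      qed
      moreover have "0 \<le> F x0"
        using zn[OF x0(1) x0x1] logistic_pos[of x0] by (simp add: F_def)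
      moreover have "F xK < D * d"
      proof -
        have axK: "a \<le> xK" "x0 \<le> xK" using x0 x0_xK[of x0] by auto
        have "exp (2 * z xK - 6 * (1 - t xK)) \<le> exp 1"
          using neg t01[OF axK(2) xK] by simp
        moreover have "0 \<le> z xK / logistic xK"
          using zn[OF axK(1) xK] logistic_pos[of xK] by simp
        ultimately have "F xK \<le> z xK / logistic xK * exp 1"
          unfolding F_def by (intro mult_left_mono) auto
        also have "\<dots> < (1 / 2) / logistic xK * exp 1"
          using neg logistic_pos[of xK] by (intro mult_strict_right_mono divide_strict_right_mono) auto
        also have "\<dots> = D * d" using d by (simp add: D_def)
        finally show ?thesis .
      qed
      moreover have "d * D \<le> d * (xK - x0)"
        using x0(2) d by (intro mult_left_mono) (auto simp: M_def)
      ultimately show False by (simp add: mult.commute)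
    qed
    have late: "x0 \<le> x" "x0 + 1 \<le> x" "a \<le> x" if "xK \<le> x" for x
      using that x0_xK[of x0] x0 by auto
    have "- y xK + 1 / (8 * r) * (x1 - xK) \<le> - y x1"
    proof (rule derivative_lower_bound[OF xK])
      fix x assume x: "xK \<le> x" "x \<le> x1"
      show "((\<lambda>x. - y x) has_real_derivative - (h x * y x - z x * t x)) (at x)"
        by (intro derivative_intros y_deriv late x)
      have "h x * y x \<le> 1 / (8 * mu) * r"
        using early_mono[OF x1 x(2)] yr[OF late(3)[OF x(1)] x(2)] yn[OF late(3)[OF x(1)] x(2)] h_pos[of x] mu1
        by (intro mult_mono) (auto simp: early_def)
      also have "\<dots> = 1 / (8 * r)" using r2 r1 mu1 by (simp add: power2_eq_square field_simps)
      finally have 1: "h x * y x \<le> 1 / (8 * r)" .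
      have "1 / 2 * (1 / (2 * r)) \<le> z x * t x"
        using zK z_mono[OF late(1)[OF order_refl] x] t_big[OF late(2)[OF x(1)] x(2)] r1
        by (intro mult_mono) auto
      moreover have "1 / 2 * (1 / (2 * r)) = 2 * (1 / (8 * r))" by simp
      ultimately show "1 / (8 * r) \<le> - (h x * y x - z x * t x)" using 1 by linarith
    qed
    moreover have "1 / (8 * r) * (x1 - xK) > r"
      using r1 by (simp add: xK_def r2[symmetric] power2_eq_square field_simps)
    ultimately have "y x1 < 0" using yr[of xK] late(3)[OF order_refl] xK by simp
    then show False using yn[of x1] late(3)[OF xK] by simp
  qed
  then show thesis using M xK by (intro that[of M]) auto
qed

section \<open>Shooting\<close>

text \<open>
  Look at the first point \<open>T\<close> where the slope vanishes or \<open>A\<close> reaches \<open>pi\<close>. Arriving at \<open>pi\<close> happens with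
  positive speed, hence the solution overshoots. If the slope vanishes below \<open>pi\<close>, this is past \<open>pi/2\<close>
  by \<open>first_half_stays\<close>; there \<open>A''\<close> is negative and the solution turns back.
\<close>

lemma trichotomy:
  assumes s: "solution A B" and Aa: "0 < A a" "A a \<le> pi / 2" and Ba: "B a = sqrt lambda * sin (A a)"
    and no: "\<not> overshoots a A B" "\<not> turns_back a A B" and b: "a \<le> b"
  shows "0 < B b \<and> A b < pi"
proof (rule ccontr)
  assume neg: "\<not> ?thesis"
  define f where "f x = max (- B x) (A x - pi)" for x
  have "0 < sin (A a)" using Aa pi_gt_zero by (intro sin_gt_zero) linarith+
  then have "0 < B a" using Ba lambda by simp
  then have "f a < 0" using Aa pi_gt_zero by (simp add: f_def)
  moreover have "0 \<le> f b" using neg by (auto simp: f_def)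
  moreover have "continuous_on {a..b} f"
    unfolding f_def by (intro continuous_intros solution_continuous[OF s])
  ultimately obtain T where T: "a < T" "f T = 0" "\<And>x. a \<le> x \<Longrightarrow> x < T \<Longrightarrow> f x < 0"
    using first_zero[of a b f] b by blast
  have before: "0 < B x" "A x < pi" if "a \<le> x" "x < T" for x
    using T(3)[OF that] by (auto simp: f_def)
  have BT: "0 \<le> B T" and AT: "A T \<le> pi" and eq: "B T = 0 \<or> A T = pi"
    using T(2) by (auto simp: f_def max_def split: if_splits)
  show False
  proof (cases "A T = pi")
    case True
    have "B T \<noteq> 0"
      using equilibrium_unique[OF s _ True, of a] Aa pi_gt_zero by auto
    then have "overshoots a A B"
      using crossing_overshoots[OF s _ True] T(1) before(1) BT by auto
    with no show False by simp
  next
    case False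
    then have BT0: "B T = 0" using eq by simp
    have mono: "A x \<le> A T" if "a \<le> x" "x \<le> T" for x
    proof (rule DERIV_nonneg_imp_nondecreasing[OF that(2)])
      fix y assume "x \<le> y" "y \<le> T"
      then have "0 \<le> B y" using before(1)[of y] BT0 that by (cases "y = T") auto
      then show "\<exists>d. (A has_real_derivative d) (at y) \<and> 0 \<le> d" using solution_deriv[OF s] by blast
    qed
    have "pi / 2 < A T"
    proof (rule ccontr)
      assume "\<not> pi / 2 < A T"
      then have low: "A x \<le> pi / 2" if "a \<le> x" "x \<le> T" for x using mono[OF that] by simp
      have "0 < B T"
        by (rule first_half_stays(3)[where b = T, OF s Aa(1) _ low]) (use Ba T(1) in auto)
      then show False using BT0 by simp
    qed
    then have "0 < sin (A T)" "cos (A T) < 0"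
      using AT False cos_monotone_0_pi[of "pi/2" "A T"] by (auto intro!: sin_gt_zero)
    then have "force T (A T) (B T) < 0"
      using BT0 V_pos[of T] by (simp add: force_def mult_less_0_iff)
    from DERIV_neg_dec_right[OF solution_deriv(2)[OF s] this]
    obtain d where d: "d > 0" "\<And>k. 0 < k \<Longrightarrow> k < d \<Longrightarrow> B (T + k) < 0" using BT0 by auto
    have "isCont A T" using solution_deriv[OF s] DERIV_isCont by blast
    then have "eventually (\<lambda>u. A u < pi) (nhds T)"
      using AT False order_tendstoD(2)[of A "A T" "nhds T" pi] by (simp add: tendsto_at_iff_tendsto_nhds isCont_def)
    then obtain e where e: "e > 0" "\<And>u. dist u T < e \<Longrightarrow> A u < pi"
      by (auto simp: eventually_nhds_metric)
    define k where "k = min d e / 2"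
    have k: "0 < k" "k < d" "k < e" using d e by (auto simp: k_def)
    have "A u < pi" if "a \<le> u" "u \<le> T + k" for u
      using before(2)[of u] e(2)[of u] that k by (cases "u < T") (auto simp: dist_real_def)
    then have "turns_back a A B"
      unfolding turns_back_def using d(2)[OF k(1,2)] k T(1) by (intro exI[of _ "T + k"]) auto
    with no show False by simp
  qed
qed

lemma shooting_family_lipschitz:
  assumes fam: "\<And>p. solution (A p) (B p) \<and> A p a = p \<and> B p a = sqrt lambda * sin p"
  obtains C where "C > 0"
    "\<And>p p' x. a \<le> x \<Longrightarrow> x \<le> X \<Longrightarrow> \<bar>A p x - A p' x\<bar> \<le> C * \<bar>p - p'\<bar> \<and> \<bar>B p x - B p' x\<bar> \<le> C * \<bar>p - p'\<bar>"
proof -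
  \<comment> \<open>The factor \<open>1 + lambda\<close> bounds the squared distance of the initial data \<open>(p, sqrt lambda sin p)\<close>.\<close>
  define C where "C = sqrt ((1 + lambda) * exp (growth * (X - a)))"
  have C: "C > 0" "C\<^sup>2 = (1 + lambda) * exp (growth * (X - a))" using lambda by (auto simp: C_def)
  have g: "growth > 0" using kappa lambda lambda_less_mu by (simp add: growth_def)
  have "\<bar>A p x - A p' x\<bar> \<le> C * \<bar>p - p'\<bar> \<and> \<bar>B p x - B p' x\<bar> \<le> C * \<bar>p - p'\<bar>" if x: "a \<le> x" "x \<le> X" for p p' x
  proof -
    have "(sin p - sin p')\<^sup>2 \<le> (p - p')\<^sup>2"
      using sin_lipschitz[of p p'] by (simp add: abs_le_square_iff)
    then have init: "(A p a - A p' a)\<^sup>2 + (B p a - B p' a)\<^sup>2 \<le> (1 + lambda) * (p - p')\<^sup>2"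
      using fam[of p] fam[of p'] lambda
      by (simp add: right_diff_distrib[symmetric] power_mult_distrib distrib_right)
    have "(A p x - A p' x)\<^sup>2 + (B p x - B p' x)\<^sup>2
      \<le> ((A p a - A p' a)\<^sup>2 + (B p a - B p' a)\<^sup>2) * exp (growth * \<bar>x - a\<bar>)"
      using solution_dependence fam by blast
    also have "\<dots> \<le> ((1 + lambda) * (p - p')\<^sup>2) * exp (growth * (X - a))"
      using init x g lambda by (intro mult_mono) auto
    also have "\<dots> = (C * \<bar>p - p'\<bar>)\<^sup>2" by (simp add: power_mult_distrib C)
    finally have le: "(A p x - A p' x)\<^sup>2 + (B p x - B p' x)\<^sup>2 \<le> (C * \<bar>p - p'\<bar>)\<^sup>2" .
    have "\<bar>A p x - A p' x\<bar>\<^sup>2 \<le> (C * \<bar>p - p'\<bar>)\<^sup>2" "\<bar>B p x - B p' x\<bar>\<^sup>2 \<le> (C * \<bar>p - p'\<bar>)\<^sup>2"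
      using le zero_le_power2[of "A p x - A p' x"] zero_le_power2[of "B p x - B p' x"]
      by (simp_all only: power2_abs)
    then show ?thesis using C(1) by (auto intro: power2_le_imp_le)
  qed
  with C(1) show thesis by (rule that)
qed

lemma open_overshoots:
  assumes fam: "\<And>p. solution (A p) (B p) \<and> A p a = p \<and> B p a = sqrt lambda * sin p"
  shows "open {p. overshoots a (A p) (B p)}"
  unfolding open_dist
proof safe
  fix p assume "overshoots a (A p) (B p)"
  then obtain x where x: "a \<le> x" "pi < A p x" "\<forall>u\<in>{a..x}. 0 < B p u" unfolding overshoots_def by blast
  obtain C where C: "C > 0"
    "\<And>p p' u. a \<le> u \<Longrightarrow> u \<le> x \<Longrightarrow> \<bar>A p u - A p' u\<bar> \<le> C * \<bar>p - p'\<bar> \<and> \<bar>B p u - B p' u\<bar> \<le> C * \<bar>p - p'\<bar>"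
    using shooting_family_lipschitz[OF fam] by blast
  have "continuous_on {a..x} (B p)" using solution_continuous fam by blast
  then obtain w where w: "w \<in> {a..x}" "\<forall>u\<in>{a..x}. B p w \<le> B p u"
    using continuous_attains_inf[of "{a..x}" "B p"] x by auto
  define e where "e = min (B p w) (A p x - pi) / C"
  have e: "e > 0" using x w C by (simp add: e_def)
  have Ce: "C * e = min (B p w) (A p x - pi)" using C by (simp add: e_def)
  show "\<exists>e>0. \<forall>p'. dist p' p < e \<longrightarrow> p' \<in> {p. overshoots a (A p) (B p)}"
  proof (intro exI conjI allI impI CollectI)
    fix p' assume "dist p' p < e"
    then have "C * \<bar>p' - p\<bar> < C * e" using C(1) by (simp add: dist_real_def)
    then have lt: "C * \<bar>p' - p\<bar> < B p w" "C * \<bar>p' - p\<bar> < A p x - pi" using Ce by auto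
    have "0 < B p' u" if "u \<in> {a..x}" for u
      using C(2)[of u p' p] lt(1) w(2) that by force
    moreover have "pi < A p' x" using C(2)[of x p' p] lt(2) x(1) by force
    ultimately show "overshoots a (A p') (B p')" unfolding overshoots_def using x(1) by blast
  qed (rule e)
qed

lemma open_turns_back:
  assumes fam: "\<And>p. solution (A p) (B p) \<and> A p a = p \<and> B p a = sqrt lambda * sin p"
  shows "open {p. turns_back a (A p) (B p)}"
  unfolding open_dist
proof safe
  fix p assume "turns_back a (A p) (B p)"
  then obtain x where x: "a \<le> x" "B p x < 0" "\<forall>u\<in>{a..x}. A p u < pi" unfolding turns_back_def by blast
  obtain C where C: "C > 0"
    "\<And>p p' u. a \<le> u \<Longrightarrow> u \<le> x \<Longrightarrow> \<bar>A p u - A p' u\<bar> \<le> C * \<bar>p - p'\<bar> \<and> \<bar>B p u - B p' u\<bar> \<le> C * \<bar>p - p'\<bar>"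
    using shooting_family_lipschitz[OF fam] by blast
  have "continuous_on {a..x} (A p)" using solution_continuous fam by blast
  then obtain w where w: "w \<in> {a..x}" "\<forall>u\<in>{a..x}. A p u \<le> A p w"
    using continuous_attains_sup[of "{a..x}" "A p"] x by auto
  define e where "e = min (- B p x) (pi - A p w) / C"
  have e: "e > 0" using x w C by (simp add: e_def)
  have Ce: "C * e = min (- B p x) (pi - A p w)" using C by (simp add: e_def)
  show "\<exists>e>0. \<forall>p'. dist p' p < e \<longrightarrow> p' \<in> {p. turns_back a (A p) (B p)}"
  proof (intro exI conjI allI impI CollectI)
    fix p' assume "dist p' p < e"
    then have "C * \<bar>p' - p\<bar> < C * e" using C(1) by (simp add: dist_real_def)
    then have lt: "C * \<bar>p' - p\<bar> < - B p x" "C * \<bar>p' - p\<bar> < pi - A p w" using Ce by auto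
    have "A p' u < pi" if "u \<in> {a..x}" for u
      using C(2)[of u p' p] lt(2) w(2) that by force
    moreover have "B p' x < 0" using C(2)[of x p' p] lt(1) x(1) by force
    ultimately show "turns_back a (A p') (B p')" unfolding turns_back_def using x(1) by blast
  qed (rule e)
qed

text \<open>
  The connectedness argument in \<open>p \<in> [e, pi/2]\<close>. The left end overshoots because for small \<open>p\<close> the
  solution stays close to the zero solution up to \<open>X\<close>, the right end turns back because it starts at \<open>pi/2\<close>.
  The bounds in the conclusion are independent of \<open>a\<close>, as needed for the limit.
\<close>

lemma shooting_solution_exists:
  obtains a0 M X where "a0 \<le> M"
    "\<And>a. a \<le> a0 \<Longrightarrow> \<exists>A B. solution A B \<and> (\<forall>x\<ge>a. 0 < A x \<and> A x < pi \<and> 0 < B x)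
       \<and> A M \<le> pi / 2 \<and> pi / 2 \<le> A X \<and> B M \<le> mu \<and> (\<forall>x\<in>{a..M}. sqrt lambda * sin (A x) \<le> B x)"
proof -
  obtain x0 X where X: "x0 \<le> X" "\<And>A B a. solution A B \<Longrightarrow> a \<le> x0 \<Longrightarrow> 0 < A a \<Longrightarrow> sqrt lambda * sin (A a) \<le> B a
     \<Longrightarrow> \<forall>x\<in>{a..X}. A x \<le> pi / 2 \<Longrightarrow> overshoots a A B"
    by (rule slow_start_overshoots) (rule that)
  obtain x1 where x1: "early x1" using early_exists by blast
  obtain M where M: "M \<le> x1" "\<And>A B a. solution A B \<Longrightarrow> a \<le> M \<Longrightarrow> 0 < A a \<Longrightarrow> A a \<le> pi / 2
    \<Longrightarrow> B a = sqrt lambda * sin (A a) \<Longrightarrow> pi / 2 \<le> A M \<Longrightarrow> turns_back a A B"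
    by (rule early_rise_turns_back[OF x1]) (rule that)
  have eM: "early M" using early_mono[OF x1 M(1)] .
  have "\<exists>A B. solution A B \<and> (\<forall>x\<ge>a. 0 < A x \<and> A x < pi \<and> 0 < B x)
       \<and> A M \<le> pi / 2 \<and> pi / 2 \<le> A X \<and> B M \<le> mu \<and> (\<forall>x\<in>{a..M}. sqrt lambda * sin (A x) \<le> B x)"
    if a: "a \<le> min x0 M" for a
  proof -
    have "\<forall>p. \<exists>A B. solution A B \<and> A a = p \<and> B a = sqrt lambda * sin p"
      using solution_exists by blast
    then obtain A B where fam: "\<And>p. solution (A p) (B p) \<and> A p a = p \<and> B p a = sqrt lambda * sin p"
      by metis
    obtain C where C: "C > 0"
      "\<And>p p' u. a \<le> u \<Longrightarrow> u \<le> X \<Longrightarrow> \<bar>A p u - A p' u\<bar> \<le> C * \<bar>p - p'\<bar> \<and> \<bar>B p u - B p' u\<bar> \<le> C * \<bar>p - p'\<bar>"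
      using shooting_family_lipschitz[OF fam] by blast
    \<comment> \<open>The solution starting from \<open>p = 0\<close> is zero, so \<open>C * e \<le> pi/2\<close> keeps the one from \<open>e\<close> below \<open>pi/2\<close> up to \<open>X\<close>.\<close>
    define e where "e = min (pi / 2) (pi / 2 / C)"
    have "e \<le> pi / 2 / C" by (simp add: e_def)
    then have "C * e \<le> pi / 2" using pos_le_divide_eq[OF C(1), of e "pi / 2"] by (simp only: mult.commute)
    moreover have "0 < e" "e \<le> pi / 2" using C(1) by (auto simp: e_def)
    ultimately have e: "0 < e" "e \<le> pi / 2" "C * e \<le> pi / 2" by auto
    define Up where "Up = {p. overshoots a (A p) (B p)}"
    define Back where "Back = {p. turns_back a (A p) (B p)}"
    have "open Up" "open Back" unfolding Up_def Back_def by (intro open_overshoots open_turns_back fam)+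
    have "e \<in> Up"
    proof -
      have "A e x \<le> pi / 2" if x: "a \<le> x" "x \<le> X" for x
      proof -
        have "A 0 x = 0" using equilibrium_unique[of "A 0" "B 0" 0 a x] fam[of 0] by simp
        then have "\<bar>A e x\<bar> \<le> C * e" using C(2)[OF x, of e 0] e by simp
        then show ?thesis using e(3) by linarith
      qed
      then show ?thesis using X(2)[of "A e" "B e" a] fam[of e] a e(1) by (simp add: Up_def)
    qed
    have "pi / 2 \<in> Back"
    proof -
      let ?A = "A (pi/2)" and ?B = "B (pi/2)"
      have s: "solution ?A ?B" and Aa: "?A a = pi / 2" using fam by blast+
      have Ba: "?B a = sqrt lambda * sin (?A a)" unfolding Aa using fam by blast
      have "turns_back a ?A ?B"
      proof (cases "pi / 2 \<le> ?A M")
        case True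
        then show ?thesis using M(2)[OF s _ _ _ Ba] a Aa by simp
      next
        case False
        have "\<exists>x\<in>{a..M}. ?B x < 0"
        proof (rule ccontr)
          assume "\<not> ?thesis"
          then have Bn: "0 \<le> ?B x" if "a \<le> x" "x \<le> M" for x
            using that by (auto simp: not_less)
          have "?A a \<le> ?A M"
            by (rule DERIV_nonneg_imp_nondecreasing) (use a Bn solution_deriv[OF s] in \<open>auto\<close>)
          then show False using False Aa by simp
        qed
        then obtain x where x: "a \<le> x" "x \<le> M" "?B x < 0" by auto
        have "?A u < pi" if "a \<le> u" "u \<le> x" for u
          using early_confinement(2)[OF s that(1) early_mono[OF eM] initial_energy_nonpos[OF Ba]] that x Aa pi_gt_zero
          by simp
        then show ?thesis unfolding turns_back_def using x by auto
      qed
      then show ?thesis by (simp add: Back_def)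
    qed
    have "\<exists>p\<in>{e..pi/2}. p \<notin> Up \<and> p \<notin> Back"
    proof (rule ccontr)
      assume "\<not> ?thesis"
      then have "{e..pi/2} \<subseteq> Up \<union> Back" by blast
      moreover have "Up \<inter> Back \<inter> {e..pi/2} = {}"
        using not_overshoots_and_turns_back by (auto simp: Up_def Back_def)
      ultimately have "Up \<inter> {e..pi/2} = {} \<or> Back \<inter> {e..pi/2} = {}"
        by (intro connectedD) (use \<open>open Up\<close> \<open>open Back\<close> in auto)
      then show False using \<open>e \<in> Up\<close> \<open>pi / 2 \<in> Back\<close> e by auto
    qed
    then obtain p where p: "e \<le> p" "p \<le> pi / 2" "\<not> overshoots a (A p) (B p)" "\<not> turns_back a (A p) (B p)"
      by (auto simp: Up_def Back_def)
    have s: "solution (A p) (B p)" and Aa: "A p a = p" and Ba: "B p a = sqrt lambda * sin (A p a)"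
      using fam[of p] by auto
    have p0: "0 < A p a" "A p a \<le> pi / 2" using Aa p e by auto
    have tri: "0 < B p x \<and> A p x < pi" if "a \<le> x" for x
      by (rule trichotomy[OF s p0 Ba p(3,4) that])
    have mono: "A p x \<le> A p y" if "a \<le> x" "x \<le> y" for x y
      by (rule DERIV_nonneg_imp_nondecreasing[OF that(2)])
         (use that tri solution_deriv[OF s] in \<open>meson less_imp_le order_trans\<close>)
    have AM: "A p M \<le> pi / 2" using M(2)[OF s _ p0 Ba] a p(4) by fastforce
    have AX: "pi / 2 \<le> A p X"
    proof (rule ccontr)
      assume "\<not> ?thesis"
      then have "A p x \<le> pi / 2" if "a \<le> x" "x \<le> X" for x using mono[OF that] by simp
      then show False using X(2)[OF s _ p0(1)] Ba a p(3) by simp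
    qed
    have "(B p M)\<^sup>2 \<le> V M * (sin (A p M))\<^sup>2"
      by (rule energy_stays_nonpos[OF s _ eM initial_energy_nonpos[OF Ba]]) (use a in simp)
    also have "\<dots> \<le> mu * 1"
      using V_le[of M] V_pos[of M] by (intro mult_mono) (auto simp: abs_square_le_1)
    also have "\<dots> \<le> mu\<^sup>2" using lambda lambda_less_mu by (simp add: power2_eq_square)
    finally have BM: "B p M \<le> mu" using lambda lambda_less_mu by (auto intro: power2_le_imp_le)
    have half: "sqrt lambda * sin (A p x) \<le> B p x" if "x \<in> {a..M}" for x
    proof (rule first_half_stays(2)[OF s p0(1), of M])
      show "A p x \<le> pi / 2" if "a \<le> x" "x \<le> M" for x using mono[OF that] AM by simp
    qed (use Ba that in auto)
    have "0 < A p x \<and> A p x < pi \<and> 0 < B p x" if "a \<le> x" for x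
      using tri[OF that] mono[OF order_refl that] p0 by simp
    then show ?thesis using s AM AX BM half by blast
  qed
  then show thesis by (intro that[of "min x0 M" M X]) auto
qed

section \<open>The limit of far left starting points\<close>

lemma solutions_converge:
  fixes A B :: "nat \<Rightarrow> real \<Rightarrow> real"
  assumes s: "\<And>n. solution (A n) (B n)" and s': "solution A' B'"
    and "(\<lambda>n. A n x0) \<longlonglongrightarrow> A' x0" "(\<lambda>n. B n x0) \<longlonglongrightarrow> B' x0"
  shows "(\<lambda>n. A n x) \<longlonglongrightarrow> A' x" "(\<lambda>n. B n x) \<longlonglongrightarrow> B' x"
proof -
  define E where "E = exp (growth * \<bar>x - x0\<bar>)"
  define D where "D n = sqrt (((A n x0 - A' x0)\<^sup>2 + (B n x0 - B' x0)\<^sup>2) * E)" for n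
  have "D \<longlonglongrightarrow> sqrt (((A' x0 - A' x0)\<^sup>2 + (B' x0 - B' x0)\<^sup>2) * E)"
    unfolding D_def by (intro tendsto_intros assms)
  then have D: "D \<longlonglongrightarrow> 0" by simp
  have le: "\<bar>A n x - A' x\<bar> \<le> D n" "\<bar>B n x - B' x\<bar> \<le> D n" for n
  proof -
    have "(A n x - A' x)\<^sup>2 + (B n x - B' x)\<^sup>2 \<le> ((A n x0 - A' x0)\<^sup>2 + (B n x0 - B' x0)\<^sup>2) * E"
      unfolding E_def by (rule solution_dependence[OF s s'])
    then have "sqrt ((A n x - A' x)\<^sup>2 + (B n x - B' x)\<^sup>2) \<le> D n"
      by (simp add: D_def)
    moreover have "\<bar>A n x - A' x\<bar> \<le> sqrt ((A n x - A' x)\<^sup>2 + (B n x - B' x)\<^sup>2)"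
      using real_sqrt_sum_squares_ge1[of "\<bar>A n x - A' x\<bar>" "B n x - B' x"] by (simp only: power2_abs)
    moreover have "\<bar>B n x - B' x\<bar> \<le> sqrt ((A n x - A' x)\<^sup>2 + (B n x - B' x)\<^sup>2)"
      using real_sqrt_sum_squares_ge2[of "\<bar>B n x - B' x\<bar>" "A n x - A' x"] by (simp only: power2_abs)
    ultimately show "\<bar>A n x - A' x\<bar> \<le> D n" "\<bar>B n x - B' x\<bar> \<le> D n" by linarith+
  qed
  show "(\<lambda>n. A n x) \<longlonglongrightarrow> A' x" "(\<lambda>n. B n x) \<longlonglongrightarrow> B' x"
    using tendsto_rabs_zero_cancel[OF tendsto_sandwich[OF _ _ tendsto_const D], THEN LIM_zero_cancel] le
    by (simp_all add: always_eventually)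
qed

text \<open>
  The bounds at \<open>M\<close> and \<open>X\<close> are what prevents the limit from being one of the rest points \<open>0\<close> and \<open>pi\<close>.
  The slope bound left of \<open>M\<close> excludes the rest point \<open>pi/2\<close>.
\<close>

lemma limiting_solution:
  obtains A B M X where "solution A B" "\<And>x. 0 \<le> A x \<and> A x \<le> pi \<and> 0 \<le> B x"
    "\<And>x. x \<le> M \<Longrightarrow> sqrt lambda * sin (A x) \<le> B x" "A M \<le> pi / 2" "pi / 2 \<le> A X"
proof -
  obtain a0 M X where a0: "a0 \<le> M" and shoot:
    "\<And>a. a \<le> a0 \<Longrightarrow> \<exists>A B. solution A B \<and> (\<forall>x\<ge>a. 0 < A x \<and> A x < pi \<and> 0 < B x)
       \<and> A M \<le> pi / 2 \<and> pi / 2 \<le> A X \<and> B M \<le> mu \<and> (\<forall>x\<in>{a..M}. sqrt lambda * sin (A x) \<le> B x)"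
    by (rule shooting_solution_exists) (rule that)
  define P where "P n A B \<longleftrightarrow> solution A B \<and> (\<forall>x\<ge>a0 - real n. 0 < A x \<and> A x < pi \<and> 0 < B x)
       \<and> A M \<le> pi / 2 \<and> pi / 2 \<le> A X \<and> B M \<le> mu
       \<and> (\<forall>x\<in>{a0 - real n..M}. sqrt lambda * sin (A x) \<le> B x)" for n and A B :: "real \<Rightarrow> real"
  have "\<forall>n. \<exists>A B. P n A B"
    unfolding P_def by (intro allI shoot) simp
  then obtain A B where P: "\<And>n. P n (A n) (B n)" by metis
  have s: "solution (A n) (B n)" and AM: "A n M \<le> pi / 2" and AX: "pi / 2 \<le> A n X" and BM: "B n M \<le> mu" for n
    using P[of n] by (auto simp: P_def)
  have bnd: "0 < A n x \<and> A n x < pi \<and> 0 < B n x" if "a0 - real n \<le> x" for n x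
    using P[of n] that by (auto simp: P_def)
  have half: "sqrt lambda * sin (A n x) \<le> B n x" if "a0 - real n \<le> x" "x \<le> M" for n x
    using P[of n] that by (auto simp: P_def)
  have "seq_compact ({0..pi/2} \<times> {0..mu})"
    by (intro compact_imp_seq_compact compact_Times compact_Icc)
  moreover have "\<forall>n. (A n M, B n M) \<in> {0..pi/2} \<times> {0..mu}"
    using bnd[of _ M] AM BM a0 by (auto simp: less_imp_le)
  ultimately obtain l r where r: "strict_mono r" and l: "((\<lambda>n. (A n M, B n M)) \<circ> r) \<longlonglongrightarrow> l"
    by (rule seq_compactE)
  obtain A' B' where s': "solution A' B'" and l': "A' M = fst l" "B' M = snd l"
    using solution_exists by blast
  have "(\<lambda>n. A (r n) M) \<longlonglongrightarrow> A' M" "(\<lambda>n. B (r n) M) \<longlonglongrightarrow> B' M"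
    using tendsto_fst[OF l] tendsto_snd[OF l] by (simp_all add: l' o_def)
  then have lim: "(\<lambda>n. A (r n) x) \<longlonglongrightarrow> A' x" "(\<lambda>n. B (r n) x) \<longlonglongrightarrow> B' x" for x
    using solutions_converge[of "\<lambda>n. A (r n)" "\<lambda>n. B (r n)", OF s s'] by blast+
  have ev: "eventually (\<lambda>n. a0 - real (r n) \<le> x) sequentially" for x
  proof -
    have "eventually (\<lambda>n. n \<ge> nat \<lceil>a0 - x\<rceil>) sequentially" by (rule eventually_ge_at_top)
    then show ?thesis
    proof eventually_elim
      case (elim n)
      then have "nat \<lceil>a0 - x\<rceil> \<le> r n" using seq_suble[OF r, of n] by simp
      then show ?case by linarith
    qed
  qed
  show thesis
  proof (rule that[OF s'])
    fix x
    show "0 \<le> A' x \<and> A' x \<le> pi \<and> 0 \<le> B' x"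
    proof (intro conjI)
      show "0 \<le> A' x"
        by (rule tendsto_lowerbound[OF lim(1)]) (use ev[of x] bnd in \<open>auto elim!: eventually_mono simp: less_imp_le\<close>)
      show "A' x \<le> pi"
        by (rule tendsto_upperbound[OF lim(1)]) (use ev[of x] bnd in \<open>auto elim!: eventually_mono simp: less_imp_le\<close>)
      show "0 \<le> B' x"
        by (rule tendsto_lowerbound[OF lim(2)]) (use ev[of x] bnd in \<open>auto elim!: eventually_mono simp: less_imp_le\<close>)
    qed
    show "sqrt lambda * sin (A' x) \<le> B' x" if "x \<le> M"
    proof (rule tendsto_le[OF _ lim(2)])
      show "(\<lambda>n. sqrt lambda * sin (A (r n) x)) \<longlonglongrightarrow> sqrt lambda * sin (A' x)"
        by (intro tendsto_intros lim)
      show "eventually (\<lambda>n. sqrt lambda * sin (A (r n) x) \<le> B (r n) x) sequentially"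
        using ev[of x] by eventually_elim (use half that in auto)
    qed simp
  next
    show "A' M \<le> pi / 2" by (rule tendsto_upperbound[OF lim(1)]) (intro always_eventually allI AM, simp)
    show "pi / 2 \<le> A' X" by (rule tendsto_lowerbound[OF lim(1)]) (intro always_eventually allI AX, simp)
  qed
qed

text \<open>
  A nondecreasing solution with values in \<open>[0, pi]\<close> that touched \<open>0\<close> or \<open>pi\<close> would rest there, against the
  bounds at \<open>M\<close> and \<open>X\<close>. Left of \<open>M\<close>, if \<open>A\<close> stayed away from \<open>0\<close>, the slope bound would give it a
  definite speed all the way to \<open>- \<infinity>\<close>. At the right end, \<open>A\<close> exceeds \<open>pi/2\<close> somewhere, since otherwise it
  would rest at \<open>pi/2\<close>. If from there on it stayed below some \<open>e < pi\<close>, the force would be at most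
  \<open>kappa A' - c\<close> with \<open>c > 0\<close>; integrated, this bounds \<open>A'\<close> by a constant minus \<open>c x\<close>, against \<open>A' \<ge> 0\<close>.
\<close>

theorem connecting_solution:
  obtains A B where "solution A B" "\<And>x. 0 < A x \<and> A x < pi" "(A \<longlongrightarrow> 0) at_bot" "(A \<longlongrightarrow> pi) at_top"
proof -
  obtain A B M X where s: "solution A B" and bnd: "\<And>x. 0 \<le> A x \<and> A x \<le> pi \<and> 0 \<le> B x"
    and half: "\<And>x. x \<le> M \<Longrightarrow> sqrt lambda * sin (A x) \<le> B x" and AM: "A M \<le> pi / 2" and AX: "pi / 2 \<le> A X"
    by (rule limiting_solution) (rule that)
  have mono: "A x \<le> A y" if "x \<le> y" for x y
    by (rule DERIV_nonneg_imp_nondecreasing[OF that]) (use bnd solution_deriv[OF s] in blast)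
  have pos: "0 < A x" for x
  proof (rule ccontr)
    assume "\<not> 0 < A x"
    then have 0: "A x = 0" using bnd[of x] by simp
    then have "B x = 0"
      using DERIV_local_min[OF solution_deriv(1)[OF s], of 1 x] bnd by auto
    then show False using equilibrium_unique[OF s _ 0, of X] AX pi_gt_zero by simp
  qed
  have less: "A x < pi" for x
  proof (rule ccontr)
    assume "\<not> A x < pi"
    then have 0: "A x = pi" using bnd[of x] by simp
    then have "B x = 0"
      using DERIV_local_max[OF solution_deriv(1)[OF s], of 1 x] bnd by auto
    then show False using equilibrium_unique[OF s _ 0, of M] AM pi_gt_zero by simp
  qed
  have small: "\<exists>x. A x < e" if e: "0 < e" for e
  proof (rule ccontr)
    assume neg: "\<not> ?thesis"
    \<comment> \<open>Between \<open>min e (pi/2)\<close> and \<open>pi/2\<close> the slope is at least \<open>c\<close>; at \<open>M - pi / c\<close> the value of \<open>A\<close> would be negative.\<close>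
    define c where "c = sin (min e (pi / 2))"
    have c: "0 < c" unfolding c_def using e pi_gt_zero by (intro sin_gt_zero) (auto simp: min_less_iff_disj)
    define x where "x = M - pi / c"
    have "A x + c * (M - x) \<le> A M"
    proof (rule derivative_lower_bound[OF _ solution_deriv(1)[OF s]])
      show "x \<le> M" using c by (simp add: x_def)
      fix y assume y: "x \<le> y" "y \<le> M"
      have "c \<le> sin (A y)"
        unfolding c_def
      proof (rule sin_monotone_2pi_le)
        show "- (pi / 2) \<le> min e (pi / 2)" using e pi_gt_zero by linarith
        show "min e (pi / 2) \<le> A y" using neg by (auto simp: not_less min_le_iff_disj)
        show "A y \<le> pi / 2" using mono[OF y(2)] AM by linarith
      qed
      also have "\<dots> \<le> sqrt lambda * sin (A y)"
        using mult_right_mono[of 1 "sqrt lambda" "sin (A y)"] lambda pos[of y] less[of y] by (simp add: sin_ge_zero)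
      also have "\<dots> \<le> B y" by (rule half[OF y(2)])
      finally show "c \<le> B y" .
    qed
    then show False using c less[of M] pos[of x] by (simp add: x_def)
  qed
  have bot: "(A \<longlongrightarrow> 0) at_bot"
  proof (rule order_tendstoI)
    fix e :: real assume "e < 0"
    then show "eventually (\<lambda>x. e < A x) at_bot" using pos by (auto intro: always_eventually less_trans)
  next
    fix e :: real assume "0 < e"
    then obtain x where "A x < e" using small by blast
    then show "eventually (\<lambda>x. A x < e) at_bot"
      unfolding eventually_at_bot_linorder using mono by (meson le_less_trans)
  qed
  have "\<exists>b. pi / 2 < A b"
  proof (rule ccontr)
    assume "\<not> ?thesis"
    then have le: "A x \<le> pi / 2" for x by (simp add: not_less)
    have 1: "A X = pi / 2" by (rule antisym[OF le AX])
    have "A y \<le> A X" for y using le[of y] unfolding 1 .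
    then have "B X = 0"
      using DERIV_local_max[OF solution_deriv(1)[OF s], of 1 X] by auto
    then have "A x = pi / 2" for x using equilibrium_unique[OF s _ 1] by simp
    then show False using small[of "pi / 2"] by simp
  qed
  then obtain b where b: "pi / 2 < A b" by blast
  have large: "\<exists>x. e < A x" if e: "e < pi" for e
  proof (rule ccontr)
    assume neg: "\<not> ?thesis"
    \<comment> \<open>For \<open>A\<close> between \<open>A b > pi/2\<close> and \<open>e\<close>, the product \<open>- sin A cos A\<close> is at least \<open>c\<close>, and \<open>V \<ge> 1\<close>.\<close>
    define c where "c = sin e * (- cos (A b))"
    have be: "A b \<le> e" using neg by (simp add: not_less)
    have sb: "0 < - cos (A b)" using b less[of b] cos_monotone_0_pi[of "pi/2" "A b"] by simp
    have se: "0 < sin e" using b be e by (intro sin_gt_zero) auto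
    have c: "0 < c" unfolding c_def by (rule mult_pos_pos[OF se sb])
    define x where "x = b + (B b + kappa * pi + 1) / c"
    have bx: "b \<le> x" using bnd[of b] kappa c by (simp add: x_def)
    have "kappa * A b - B b + c * (x - b) \<le> kappa * A x - B x"
    proof (rule derivative_lower_bound[OF bx])
      fix y assume y: "b \<le> y" "y \<le> x"
      show "((\<lambda>x. kappa * A x - B x) has_real_derivative kappa * B y - force y (A y) (B y)) (at y)"
        by (auto intro!: derivative_eq_intros solution_deriv[OF s])
      have "sin e \<le> sin (A y)"
      proof -
        have "sin (pi - e) \<le> sin (pi - A y)"
        proof (rule sin_monotone_2pi_le)
          show "- (pi / 2) \<le> pi - e" using e pi_gt_zero by linarith
          show "pi - e \<le> pi - A y" using neg by (simp add: not_less)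
          show "pi - A y \<le> pi / 2" using mono[OF y(1)] b by linarith
        qed
        then show ?thesis by simp
      qed
      moreover have "- cos (A b) \<le> - cos (A y)"
        using mono[OF y(1)] less[of y] pos[of b] by (simp add: cos_monotone_0_pi_le)
      ultimately have "c \<le> sin (A y) * (- cos (A y))"
        unfolding c_def using sb se by (intro mult_mono) auto
      also have "\<dots> \<le> V y * (sin (A y) * (- cos (A y)))"
        using mult_right_mono[of 1 "V y" "sin (A y) * (- cos (A y))"] calculation c V_gt[of y] lambda by simp
      finally have "c \<le> V y * (sin (A y) * (- cos (A y)))" .
      moreover have "h y * B y \<le> kappa * B y" using h_le[of y] bnd[of y] by (intro mult_right_mono) auto
      ultimately show "c \<le> kappa * B y - force y (A y) (B y)"
        by (simp add: force_def mult.assoc)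
    qed
    moreover have "c * (x - b) = B b + kappa * pi + 1" using c by (simp add: x_def)
    moreover have "kappa * A x \<le> kappa * pi" "0 \<le> kappa * A b"
      using kappa less[of x] pos[of b] by auto
    ultimately show False using bnd[of x] by linarith
  qed
  have top: "(A \<longlongrightarrow> pi) at_top"
  proof (rule order_tendstoI)
    fix e :: real assume "pi < e"
    then show "eventually (\<lambda>x. A x < e) at_top" using less by (auto intro: always_eventually less_trans)
  next
    fix e :: real assume "e < pi"
    then obtain x where "e < A x" using large by blast
    then show "eventually (\<lambda>x. e < A x) at_top"
      unfolding eventually_at_top_linorder using mono by (meson less_le_trans)
  qed
  show thesis using that[OF s _ bot top] pos less by blast
qed

end

section \<open>The boundary value problem\<close>

theorem theorem1p1:
  fixes q :: nat and lambda mu :: real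
  assumes "q > 1"
    and "lambda \<ge> 1"
    and "mu > lambda * real q"
  shows "\<exists>\<alpha> \<alpha>' \<alpha>'' :: real \<Rightarrow> real.
    (\<forall>t\<in>{0<..<pi/2}. (\<alpha> has_real_derivative \<alpha>' t) (at t)) \<and>
    (\<forall>t\<in>{0<..<pi/2}. (\<alpha>' has_real_derivative \<alpha>'' t) (at t)) \<and>
    continuous_on {0<..<pi/2} \<alpha>'' \<and>
    (\<forall>t\<in>{0<..<pi/2}.
       \<alpha>'' t + (cot t - real q * tan t) * \<alpha>' t
         - (lambda / (sin t)\<^sup>2 + mu / (cos t)\<^sup>2) * sin (\<alpha> t) * cos (\<alpha> t) = 0) \<and>
    (\<alpha> \<longlongrightarrow> 0) (at_right 0) \<and>
    (\<alpha> \<longlongrightarrow> pi) (at_left (pi/2)) \<and>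
    (\<forall>t\<in>{0<..<pi/2}. 0 < \<alpha> t \<and> \<alpha> t < pi)"
proof -
  define kappa where "kappa = real q - 1"
  interpret join_equation kappa lambda mu
    by unfold_locales (use assms in \<open>auto simp: kappa_def algebra_simps\<close>)
  obtain A B where s: "solution A B" and bnd: "\<And>x. 0 < A x \<and> A x < pi"
    and bot: "(A \<longlongrightarrow> 0) at_bot" and top: "(A \<longlongrightarrow> pi) at_top"
    by (rule connecting_solution) (rule that)
  define g where "g t = ln (tan t)" for t :: real
  have sc: "0 < sin t" "0 < cos t" "0 < tan t" if "t \<in> {0<..<pi/2}" for t
    using that by (auto intro!: sin_gt_zero cos_gt_zero tan_gt_zero)
  have g: "(g has_real_derivative 1 / (sin t * cos t)) (at t)" if "t \<in> {0<..<pi/2}" for t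
    unfolding g_def using sc[OF that]
    by (auto intro!: derivative_eq_intros simp: tan_def field_simps power2_eq_square)
  have lg: "logistic (g t) = (sin t)\<^sup>2" if "t \<in> {0<..<pi/2}" for t
  proof -
    have "exp (- 2 * g t) = 1 / (tan t)\<^sup>2"
      using sc[OF that] exp_of_nat_mult[of 2 "g t"] by (simp add: g_def exp_minus field_simps)
    then have "logistic (g t) = 1 / (1 + (cos t)\<^sup>2 / (sin t)\<^sup>2)"
      by (simp add: logistic_def tan_def power_divide)
    also have "\<dots> = (sin t)\<^sup>2 / ((sin t)\<^sup>2 + (cos t)\<^sup>2)"
      using sc[OF that] by (simp add: field_simps)
    finally show ?thesis by simp
  qed
  define \<alpha> where "\<alpha> t = A (g t)" for t
  define \<alpha>' where "\<alpha>' t = B (g t) / (sin t * cos t)" for t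
  define \<alpha>'' where "\<alpha>'' t = (force (g t) (A (g t)) (B (g t)) - B (g t) * ((cos t)\<^sup>2 - (sin t)\<^sup>2)) / (sin t * cos t)\<^sup>2" for t
  have 1: "(\<alpha> has_real_derivative \<alpha>' t) (at t)" if "t \<in> {0<..<pi/2}" for t
    unfolding \<alpha>_def \<alpha>'_def
    using DERIV_chain2[OF solution_deriv(1)[OF s] g[OF that]] by simp
  have 2: "(\<alpha>' has_real_derivative \<alpha>'' t) (at t)" if t: "t \<in> {0<..<pi/2}" for t
    unfolding \<alpha>'_def \<alpha>''_def
    using sc[OF t]
    by (auto intro!: derivative_eq_intros DERIV_chain2[OF solution_deriv(2)[OF s] g[OF t]]
        simp: field_simps power2_eq_square)
  have gc: "continuous_on {0<..<pi/2} g"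
    using g by (meson DERIV_isCont continuous_at_imp_continuous_on)
  have 3: "continuous_on {0<..<pi/2} \<alpha>''"
    unfolding \<alpha>''_def force_def
    by (intro continuous_intros gc continuous_on_compose2[OF solution_continuous(1)[OF s, of UNIV] gc]
        continuous_on_compose2[OF solution_continuous(2)[OF s, of UNIV] gc]
        continuous_on_compose2[OF continuous_on_h[of UNIV] gc] continuous_on_compose2[OF continuous_on_V[of UNIV] gc])
       (use sc in force)+
  have 4: "\<alpha>'' t + (cot t - real q * tan t) * \<alpha>' t
         - (lambda / (sin t)\<^sup>2 + mu / (cos t)\<^sup>2) * sin (\<alpha> t) * cos (\<alpha> t) = 0" if t: "t \<in> {0<..<pi/2}" for t
  proof -
    define S C where "S = sin t" and "C = cos t"
    have SC: "S \<noteq> 0" "C \<noteq> 0" "C\<^sup>2 = 1 - S\<^sup>2" using sc[OF t] by (auto simp: S_def C_def cos_squared_eq)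
    have "(\<alpha>'' t + (cot t - real q * tan t) * \<alpha>' t
         - (lambda / (sin t)\<^sup>2 + mu / (cos t)\<^sup>2) * sin (\<alpha> t) * cos (\<alpha> t)) * (S * C)\<^sup>2
       = force (g t) (A (g t)) (B (g t)) - B (g t) * (C\<^sup>2 - S\<^sup>2) + (C\<^sup>2 - real q * S\<^sup>2) * B (g t)
         - (lambda * C\<^sup>2 + mu * S\<^sup>2) * sin (A (g t)) * cos (A (g t))"
      unfolding \<alpha>_def \<alpha>'_def \<alpha>''_def cot_def tan_def S_def[symmetric] C_def[symmetric]
      using SC(1,2) by (simp add: field_simps power2_eq_square)
    also have "\<dots> = 0"
      unfolding SC(3) force_def h_def V_def lg[OF t] S_def[symmetric]
      by (simp add: kappa_def algebra_simps)
    finally show ?thesis using SC by simp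
  qed
  have 5: "(\<alpha> \<longlongrightarrow> 0) (at_right 0)"
  proof -
    have "filterlim tan (at_right 0) (at_right (0::real))"
    proof -
      have "(tan \<longlongrightarrow> tan 0) (at_right (0::real))" by (intro tendsto_intros) auto
      moreover have "eventually (\<lambda>t. tan t \<in> {0<..} \<and> tan t \<noteq> 0) (at_right (0::real))"
        unfolding eventually_at_right_field using sc(3) by (intro exI[of _ "pi/2"]) force
      ultimately show ?thesis unfolding filterlim_at by (auto elim: eventually_mono)
    qed
    then have "filterlim g at_bot (at_right 0)"
      unfolding g_def by (rule filterlim_compose[OF ln_at_0])
    then show ?thesis unfolding \<alpha>_def by (rule filterlim_compose[OF bot])
  qed
  have 6: "(\<alpha> \<longlongrightarrow> pi) (at_left (pi/2))"
  proof -
    have "filterlim g at_top (at_left (pi/2))"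
      unfolding g_def by (rule filterlim_compose[OF ln_at_top filterlim_tan_at_left])
    then show ?thesis unfolding \<alpha>_def by (rule filterlim_compose[OF top])
  qed
  show ?thesis
    by (intro exI[of _ \<alpha>] exI[of _ \<alpha>'] exI[of _ \<alpha>''] conjI ballI 1 2 3 4 5 6) (use bnd in \<open>auto simp: \<alpha>_def\<close>)
qed

end
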